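(* The cut rule is admissible for the sequent system $\mathcal D$: every (ground, normal-form) sequent derivable in $\mathcal D$ has a derivation in $\mathcal D$ with no instance of $cut$.
   Context: Messages: names and terms built from constructors $\mathsf{pub}$ (unary), $\mathsf{sign}$, $\mathsf{blind}$, $\langle\cdot,\cdot\rangle$, $\{\cdot\}_\cdot$ (binary) and function symbols of $\Sigma_E=\Sigma_{E_1}\cup\cdots\cup\Sigma_{E_n}$, where the $\Sigma_{E_i}$ are pairwise disjoint and disjoint from the constructors; all messages are ground. $E$ is the disjoint combination of equational theories $E_1,\ldots,E_n$, $E_i$ over $\Sigma_{E_i}$ containing at most one associative-commutative binary symbol $\oplus_i$; $E$ is presented by a rewrite system terminating and confluent modulo AC of the $\oplus_i$. $\equiv$: equality modulo AC; $\approx_E$: equality modulo $E$; all terms in sequents are in $E$-normal form. A term is $E_i$-alien if headed by a symbol not in $\Sigma_{E_i}$; an $E_i$-alien subterm $A$ of $N$ is an $E_i$-factor of $N$ if $A$ is an immediate subterm of a subterm of $N$ headed by a symbol of $\Sigma_{E_i}$ ($E_i$-factor of a set: of some member). An $E_i$-context is a term built from holes using only symbols of $\Sigma_{E_i}$; $C[M_1,\ldots,M_k]$ fills its holes in order. $\Gamma, M$ means $\Gamma\cup\{M\}$. System $\mathcal D$ (premises $\Rightarrow$ conclusion): ($id_{E_i}$), for each $i$: $\Gamma\vdash M$ if $M\approx_E C[M_1,\ldots,M_k]$ for an $E_i$-context $C$ and $M_1,\ldots,M_k\in\Gamma$; (cut) $\Gamma\vdash M$, $\Gamma,M\vdash T\Rightarrow\Gamma\vdash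 T$; (acut) $\Gamma\vdash N$, $\Gamma,N\vdash M\Rightarrow\Gamma\vdash M$ where $N$ is an $E_i$-factor of $\Gamma\cup\{M\}$ for some $i$; ($p_L$) $\Gamma,\langle M,N\rangle,M,N\vdash T\Rightarrow\Gamma,\langle M,N\rangle\vdash T$; ($p_R$) $\Gamma\vdash M,\Gamma\vdash N\Rightarrow\Gamma\vdash\langle M,N\rangle$; ($e_L$) $\Gamma,\{M\}_K\vdash K$, $\Gamma,\{M\}_K,M,K\vdash N\Rightarrow\Gamma,\{M\}_K\vdash N$; ($e_R$) $\Gamma\vdash M,\Gamma\vdash K\Rightarrow\Gamma\vdash\{M\}_K$; ($\mathsf{sign}_L$) $\Gamma,\mathsf{sign}(M,K),\mathsf{pub}(L),M\vdash N\Rightarrow\Gamma,\mathsf{sign}(M,K),\mathsf{pub}(L)\vdash N$ if $K\equiv L$; ($\mathsf{sign}_R$) $\Gamma\vdash M,\Gamma\vdash K\Rightarrow\Gamma\vdash\mathsf{sign}(M,K)$; ($\mathsf{blind}_{L1}$) $\Gamma,\mathsf{blind}(M,K)\vdash K$, $\Gamma,\mathsf{blind}(M,K),M,K\vdash N\Rightarrow\Gamma,\mathsf{blind}(M,K)\vdash N$; ($\mathsf{blind}_R$) $\Gamma\vdash M,\Gamma\vdash K\Rightarrow\Gamma\vdash\mathsf{blind}(M,K)$; ($\mathsf{blind}_{L2}$) $\Gamma,\mathsf{sign}(\mathsf{blind}(M,R),K)\vdash R$, $\Gamma,\mathsf{sign}(\mathsf{blind}(M,R),K),\mathsf{sign}(M,K),R\vdash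 N\Rightarrow\Gamma,\mathsf{sign}(\mathsf{blind}(M,R),K)\vdash N$. *)

theory Defs
  imports Main
begin

section \<open>Terms\<close>

text \<open>Messages are the ground terms; variables occur in equations and rewrite rules, and
  termination and confluence are stated for terms with variables.\<close>

datatype ('f, 'n) msg =
    Var nat
  | Name 'n
  | Pub "('f, 'n) msg"
  | Sign "('f, 'n) msg" "('f, 'n) msg"
  | Blind "('f, 'n) msg" "('f, 'n) msg"
  | MPair "('f, 'n) msg" "('f, 'n) msg"
  | Enc "('f, 'n) msg" "('f, 'n) msg"  \<comment> \<open>\<open>Enc M K\<close> is \<open>{M}\<close> encrypted under the key \<open>K\<close>\<close>
  | Fn 'f "('f, 'n) msg list"

type_synonym ('f, 'n) eqns = "(('f, 'n) msg \<times> ('f, 'n) msg) set"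

text \<open>The component theories are indexed by \<open>1, \<dots>, num\<close>. Theory \<open>i\<close> has signature \<open>sig_of i\<close>,
  axioms \<open>axs i\<close>, and \<open>acs i\<close> is its associative-commutative symbol, if there is one.\<close>

record ('f, 'n) comb =
  num :: nat
  arity :: "'f \<Rightarrow> nat"
  sig_of :: "nat \<Rightarrow> 'f set"
  acs :: "nat \<Rightarrow> 'f option"
  axs :: "nat \<Rightarrow> ('f, 'n) eqns"

definition sigE :: "('f, 'n) comb \<Rightarrow> 'f set" where
  "sigE Th = (\<Union>i\<in>{1..num Th}. sig_of Th i)"

definition axsE :: "('f, 'n) comb \<Rightarrow> ('f, 'n) eqns" where
  "axsE Th = (\<Union>i\<in>{1..num Th}. axs Th i)"

fun is_term :: "('f, 'n) comb \<Rightarrow> ('f, 'n) msg \<Rightarrow> bool" where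
  "is_term Th (Var x) = True"
| "is_term Th (Name a) = True"
| "is_term Th (Pub M) = is_term Th M"
| "is_term Th (Sign M K) = (is_term Th M \<and> is_term Th K)"
| "is_term Th (Blind M K) = (is_term Th M \<and> is_term Th K)"
| "is_term Th (MPair M N) = (is_term Th M \<and> is_term Th N)"
| "is_term Th (Enc M K) = (is_term Th M \<and> is_term Th K)"
| "is_term Th (Fn f ts) =
     (f \<in> sigE Th \<and> length ts = arity Th f \<and> (\<forall>t\<in>set ts. is_term Th t))"

fun ground :: "('f, 'n) msg \<Rightarrow> bool" where
  "ground (Var x) = False"
| "ground (Name a) = True"
| "ground (Pub M) = ground M"
| "ground (Sign M K) = (ground M \<and> ground K)"
| "ground (Blind M K) = (ground M \<and> ground K)"
| "ground (MPair M N) = (ground M \<and> ground N)"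
| "ground (Enc M K) = (ground M \<and> ground K)"
| "ground (Fn f ts) = (\<forall>t\<in>set ts. ground t)"

text \<open>Terms over a signature \<open>S\<close>: variables and symbols of \<open>S\<close> only.\<close>

inductive_set terms_over :: "('f, 'n) comb \<Rightarrow> 'f set \<Rightarrow> ('f, 'n) msg set"
  for Th :: "('f, 'n) comb" and S :: "'f set" where
  "Var x \<in> terms_over Th S"
| "f \<in> S \<Longrightarrow> length ts = arity Th f \<Longrightarrow> (\<And>t. t \<in> set ts \<Longrightarrow> t \<in> terms_over Th S)
     \<Longrightarrow> Fn f ts \<in> terms_over Th S"

primrec subst :: "(nat \<Rightarrow> ('f, 'n) msg) \<Rightarrow> ('f, 'n) msg \<Rightarrow> ('f, 'n) msg" where
  "subst \<sigma> (Var x) = \<sigma> x"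
| "subst \<sigma> (Name a) = Name a"
| "subst \<sigma> (Pub M) = Pub (subst \<sigma> M)"
| "subst \<sigma> (Sign M K) = Sign (subst \<sigma> M) (subst \<sigma> K)"
| "subst \<sigma> (Blind M K) = Blind (subst \<sigma> M) (subst \<sigma> K)"
| "subst \<sigma> (MPair M N) = MPair (subst \<sigma> M) (subst \<sigma> N)"
| "subst \<sigma> (Enc M K) = Enc (subst \<sigma> M) (subst \<sigma> K)"
| "subst \<sigma> (Fn f ts) = Fn f (map (subst \<sigma>) ts)"

primrec subterms :: "('f, 'n) msg \<Rightarrow> ('f, 'n) msg set" where
  "subterms (Var x) = {Var x}"
| "subterms (Name a) = {Name a}"
| "subterms (Pub M) = insert (Pub M) (subterms M)"
| "subterms (Sign M K) = insert (Sign M K) (subterms M \<union> subterms K)"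
| "subterms (Blind M K) = insert (Blind M K) (subterms M \<union> subterms K)"
| "subterms (MPair M N) = insert (MPair M N) (subterms M \<union> subterms N)"
| "subterms (Enc M K) = insert (Enc M K) (subterms M \<union> subterms K)"
| "subterms (Fn f ts) = insert (Fn f ts) (\<Union> (set (map subterms ts)))"

section \<open>Equality and rewriting\<close>

inductive rw :: "('f, 'n) eqns \<Rightarrow> ('f, 'n) msg \<Rightarrow> ('f, 'n) msg \<Rightarrow> bool"
  for A :: "('f, 'n) eqns" where
  root: "(l, r) \<in> A \<Longrightarrow> rw A (subst \<sigma> l) (subst \<sigma> r)"
| pub: "rw A s t \<Longrightarrow> rw A (Pub s) (Pub t)"
| sign1: "rw A s t \<Longrightarrow> rw A (Sign s K) (Sign t K)"
| sign2: "rw A s t \<Longrightarrow> rw A (Sign M s) (Sign M t)"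
| blind1: "rw A s t \<Longrightarrow> rw A (Blind s K) (Blind t K)"
| blind2: "rw A s t \<Longrightarrow> rw A (Blind M s) (Blind M t)"
| pair1: "rw A s t \<Longrightarrow> rw A (MPair s N) (MPair t N)"
| pair2: "rw A s t \<Longrightarrow> rw A (MPair M s) (MPair M t)"
| enc1: "rw A s t \<Longrightarrow> rw A (Enc s K) (Enc t K)"
| enc2: "rw A s t \<Longrightarrow> rw A (Enc M s) (Enc M t)"
| fn: "rw A s t \<Longrightarrow> rw A (Fn f (us @ s # vs)) (Fn f (us @ t # vs))"

text \<open>The raw type also contains ill-formed trees (wrong arity or foreign symbols); steps are
  restricted to well-formed terms.\<close>

definition step :: "('f, 'n) comb \<Rightarrow> ('f, 'n) eqns \<Rightarrow> ('f, 'n) msg \<Rightarrow> ('f, 'n) msg \<Rightarrow> bool" where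
  "step Th A s t \<longleftrightarrow> is_term Th s \<and> is_term Th t \<and> rw A s t"

definition eqE :: "('f, 'n) comb \<Rightarrow> ('f, 'n) msg \<Rightarrow> ('f, 'n) msg \<Rightarrow> bool" where
  "eqE Th = equivclp (step Th (axsE Th))"

definition ac_axioms :: "'f \<Rightarrow> ('f, 'n) eqns" where
  "ac_axioms p =
     {(Fn p [Var 0, Var 1], Fn p [Var 1, Var 0]),
      (Fn p [Fn p [Var 0, Var 1], Var 2], Fn p [Var 0, Fn p [Var 1, Var 2]])}"

definition all_ac_axioms :: "('f, 'n) comb \<Rightarrow> ('f, 'n) eqns" where
  "all_ac_axioms Th = (\<Union>{ac_axioms p | p i. i \<in> {1..num Th} \<and> acs Th i = Some p})"

definition eqAC :: "('f, 'n) comb \<Rightarrow> ('f, 'n) msg \<Rightarrow> ('f, 'n) msg \<Rightarrow> bool" where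
  "eqAC Th = equivclp (step Th (all_ac_axioms Th))"

text \<open>Rewriting modulo AC, that is, on AC-equivalence classes.\<close>

definition red :: "('f, 'n) comb \<Rightarrow> ('f, 'n) eqns \<Rightarrow> ('f, 'n) msg \<Rightarrow> ('f, 'n) msg \<Rightarrow> bool" where
  "red Th R s t \<longleftrightarrow> (\<exists>s' t'. eqAC Th s s' \<and> step Th R s' t' \<and> eqAC Th t' t)"

definition disjoint_combination :: "('f, 'n) comb \<Rightarrow> bool" where
  "disjoint_combination Th \<longleftrightarrow>
     (\<forall>i\<in>{1..num Th}. \<forall>j\<in>{1..num Th}. i \<noteq> j \<longrightarrow> sig_of Th i \<inter> sig_of Th j = {}) \<and>
     (\<forall>i\<in>{1..num Th}. \<forall>(l, r)\<in>axs Th i.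
        l \<in> terms_over Th (sig_of Th i) \<and> r \<in> terms_over Th (sig_of Th i)) \<and>
     (\<forall>i\<in>{1..num Th}. \<forall>p. acs Th i = Some p \<longrightarrow>
        p \<in> sig_of Th i \<and> arity Th p = 2 \<and> ac_axioms p \<subseteq> axs Th i)"

definition presents :: "('f, 'n) comb \<Rightarrow> ('f, 'n) eqns \<Rightarrow> bool" where
  "presents Th R \<longleftrightarrow>
     (\<forall>(l, r)\<in>R. l \<in> terms_over Th (sigE Th) \<and> r \<in> terms_over Th (sigE Th)) \<and>
     eqE Th = equivclp (step Th (R \<union> all_ac_axioms Th))"

definition terminating_AC :: "('f, 'n) comb \<Rightarrow> ('f, 'n) eqns \<Rightarrow> bool" where
  "terminating_AC Th R \<longleftrightarrow> (\<nexists>t. \<forall>k::nat. red Th R (t k) (t (Suc k)))"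

definition confluent_AC :: "('f, 'n) comb \<Rightarrow> ('f, 'n) eqns \<Rightarrow> bool" where
  "confluent_AC Th R \<longleftrightarrow>
     (\<forall>s t u. (red Th R)\<^sup>*\<^sup>* s t \<and> (red Th R)\<^sup>*\<^sup>* s u \<longrightarrow>
        (\<exists>v w. (red Th R)\<^sup>*\<^sup>* t v \<and> (red Th R)\<^sup>*\<^sup>* u w \<and> eqAC Th v w))"

definition normal :: "('f, 'n) comb \<Rightarrow> ('f, 'n) eqns \<Rightarrow> ('f, 'n) msg \<Rightarrow> bool" where
  "normal Th R s \<longleftrightarrow> (\<nexists>t. red Th R s t)"

section \<open>Contexts and factors\<close>

datatype 'f ctx = Hole | CFn 'f "'f ctx list"

inductive_set ctxs :: "('f, 'n) comb \<Rightarrow> nat \<Rightarrow> 'f ctx set"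
  for Th :: "('f, 'n) comb" and i :: nat where
  "Hole \<in> ctxs Th i"
| "f \<in> sig_of Th i \<Longrightarrow> length cs = arity Th f \<Longrightarrow> (\<And>c. c \<in> set cs \<Longrightarrow> c \<in> ctxs Th i)
     \<Longrightarrow> CFn f cs \<in> ctxs Th i"

primrec holes :: "'f ctx \<Rightarrow> nat" where
  "holes Hole = 1"
| "holes (CFn f cs) = sum_list (map holes cs)"

text \<open>\<open>fill C Ms\<close> is meaningful when \<open>length Ms = holes C\<close>.\<close>

fun fill :: "'f ctx \<Rightarrow> ('f, 'n) msg list \<Rightarrow> ('f, 'n) msg"
and fill_list :: "'f ctx list \<Rightarrow> ('f, 'n) msg list \<Rightarrow> ('f, 'n) msg list" where
  "fill Hole Ms = hd Ms"
| "fill (CFn f cs) Ms = Fn f (fill_list cs Ms)"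
| "fill_list [] Ms = []"
| "fill_list (c # cs) Ms = fill c (take (holes c) Ms) # fill_list cs (drop (holes c) Ms)"

text \<open>Names are alien to every component theory: a name is its own head symbol.\<close>

definition alien :: "('f, 'n) comb \<Rightarrow> nat \<Rightarrow> ('f, 'n) msg \<Rightarrow> bool" where
  "alien Th i t \<longleftrightarrow> \<not> (\<exists>f ts. t = Fn f ts \<and> f \<in> sig_of Th i)"

definition factor :: "('f, 'n) comb \<Rightarrow> nat \<Rightarrow> ('f, 'n) msg \<Rightarrow> ('f, 'n) msg \<Rightarrow> bool" where
  "factor Th i A N \<longleftrightarrow>
     alien Th i A \<and> (\<exists>f ts. f \<in> sig_of Th i \<and> Fn f ts \<in> subterms N \<and> A \<in> set ts)"

section \<open>The sequent system\<close>

definition sequent ::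
  "('f, 'n) comb \<Rightarrow> ('f, 'n) eqns \<Rightarrow> ('f, 'n) msg set \<Rightarrow> ('f, 'n) msg \<Rightarrow> bool" where
  "sequent Th R \<Gamma> M \<longleftrightarrow> (\<forall>N\<in>insert M \<Gamma>. is_term Th N \<and> ground N \<and> normal Th R N)"

text \<open>The Boolean argument says whether instances of the cut rule may be used. Every rule
  requires its conclusion to be a ground sequent in normal form, so this holds for all sequents of
  a derivation. As \<open>\<Gamma>, M\<close> is a union, a principal formula may also occur in \<open>\<Gamma>\<close> itself.\<close>

inductive derivable ::
  "('f, 'n) comb \<Rightarrow> ('f, 'n) eqns \<Rightarrow> bool \<Rightarrow> ('f, 'n) msg set \<Rightarrow> ('f, 'n) msg \<Rightarrow> bool"
  for Th :: "('f, 'n) comb" and R :: "('f, 'n) eqns" and with_cut :: bool where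
  id: "derivable Th R with_cut \<Gamma> M"
  if "sequent Th R \<Gamma> M" "i \<in> {1..num Th}" "C \<in> ctxs Th i" "length Ms = holes C" "set Ms \<subseteq> \<Gamma>"
     "eqE Th M (fill C Ms)"
| cut: "derivable Th R with_cut \<Gamma> T"
  if "with_cut" "sequent Th R \<Gamma> T"
     "derivable Th R with_cut \<Gamma> M" "derivable Th R with_cut (\<Gamma> \<union> {M}) T"
| acut: "derivable Th R with_cut \<Gamma> M"
  if "sequent Th R \<Gamma> M" "i \<in> {1..num Th}" "P \<in> \<Gamma> \<union> {M}" "factor Th i N P"
     "derivable Th R with_cut \<Gamma> N" "derivable Th R with_cut (\<Gamma> \<union> {N}) M"
| pL: "derivable Th R with_cut (\<Gamma> \<union> {MPair M N}) T"
  if "sequent Th R (\<Gamma> \<union> {MPair M N}) T"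
     "derivable Th R with_cut (\<Gamma> \<union> {MPair M N, M, N}) T"
| pR: "derivable Th R with_cut \<Gamma> (MPair M N)"
  if "sequent Th R \<Gamma> (MPair M N)"
     "derivable Th R with_cut \<Gamma> M" "derivable Th R with_cut \<Gamma> N"
| eL: "derivable Th R with_cut (\<Gamma> \<union> {Enc M K}) N"
  if "sequent Th R (\<Gamma> \<union> {Enc M K}) N"
     "derivable Th R with_cut (\<Gamma> \<union> {Enc M K}) K"
     "derivable Th R with_cut (\<Gamma> \<union> {Enc M K, M, K}) N"
| eR: "derivable Th R with_cut \<Gamma> (Enc M K)"
  if "sequent Th R \<Gamma> (Enc M K)"
     "derivable Th R with_cut \<Gamma> M" "derivable Th R with_cut \<Gamma> K"
| signL: "derivable Th R with_cut (\<Gamma> \<union> {Sign M K, Pub L}) N"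
  if "sequent Th R (\<Gamma> \<union> {Sign M K, Pub L}) N" "eqAC Th K L"
     "derivable Th R with_cut (\<Gamma> \<union> {Sign M K, Pub L, M}) N"
| signR: "derivable Th R with_cut \<Gamma> (Sign M K)"
  if "sequent Th R \<Gamma> (Sign M K)"
     "derivable Th R with_cut \<Gamma> M" "derivable Th R with_cut \<Gamma> K"
| blindL1: "derivable Th R with_cut (\<Gamma> \<union> {Blind M K}) N"
  if "sequent Th R (\<Gamma> \<union> {Blind M K}) N"
     "derivable Th R with_cut (\<Gamma> \<union> {Blind M K}) K"
     "derivable Th R with_cut (\<Gamma> \<union> {Blind M K, M, K}) N"
| blindR: "derivable Th R with_cut \<Gamma> (Blind M K)"
  if "sequent Th R \<Gamma> (Blind M K)"
     "derivable Th R with_cut \<Gamma> M" "derivable Th R with_cut \<Gamma> K"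
| blindL2: "derivable Th R with_cut (\<Gamma> \<union> {Sign (Blind M S) K}) N"
  if "sequent Th R (\<Gamma> \<union> {Sign (Blind M S) K}) N"
     "derivable Th R with_cut (\<Gamma> \<union> {Sign (Blind M S) K}) S"
     "derivable Th R with_cut (\<Gamma> \<union> {Sign (Blind M S) K, Sign M K, S}) N"

end

theory Submission
  imports Defs
begin

text \<open>Cut is eliminated by induction on the size of the cut formula \<open>M\<close>, then on the left derivation,
  and, when the latter ends in a right rule or in \<open>id\<close> for the theory of the head symbol of \<open>M\<close>, on
  the right derivation. The rule \<open>acut\<close> absorbs the remaining cuts: if \<open>M\<close> is alien to theory \<open>i\<close>
  and equal to an \<open>i\<close>-context over \<open>\<Gamma>\<close>, then \<open>M\<close> is modulo AC a member or a factor of \<open>\<Gamma>\<close>; and if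
  an \<open>i\<close>-context over \<open>\<Gamma>, M\<close> equals \<open>T\<close>, then \<open>M\<close> is modulo AC a member or a factor of \<open>\<Gamma>, T\<close>,
  or it can be replaced by any other term.

  As the rules of \<open>R\<close> may mix the component signatures, rewriting with \<open>R\<close> does not respect layers.
  Both facts are derived instead from a second, purely equational normal form \<open>nu\<close>, which
  collapses the layers of a term bottom-up and chooses one representative of each class modulo
  a component theory. Of \<open>R\<close> one needs little more than that equal normal terms are equal modulo AC.\<close>

section \<open>Equational closure\<close>

abbreviation conv :: "('f, 'n) comb \<Rightarrow> ('f, 'n) eqns \<Rightarrow> ('f, 'n) msg \<Rightarrow> ('f, 'n) msg \<Rightarrow> bool" where
  "conv Th A \<equiv> equivclp (step Th A)"

lemma conv_is_term: "conv Th A s t \<Longrightarrow> is_term Th s \<longleftrightarrow> is_term Th t"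
  by (induction rule: equivclp_induct) (auto simp: step_def)

lemma conv_lift:
  assumes "conv Th A s t" and "\<And>u v. step Th A u v \<Longrightarrow> step Th A (F u) (F v)"
  shows "conv Th A (F s) (F t)"
  using assms(1)
  by (induction rule: equivclp_induct)
    (auto intro: equivclp_trans equivclp_sym r_into_equivclp dest: assms(2))

lemma conv_Pub: "conv Th A s t \<Longrightarrow> conv Th A (Pub s) (Pub t)"
  by (rule conv_lift) (auto simp: step_def intro: rw.intros)

text \<open>The arguments are changed one after the other. Since \<open>step\<close> relates
  well-formed terms only, the argument held fixed has to be well formed; for the second half this is
  transferred from \<open>s\<close> to \<open>t\<close> along the conversion.\<close>

lemma conv_lift2:
  assumes "conv Th A s t" "conv Th A s' t'" "is_term Th s" "is_term Th s'"
    and 1: "\<And>u v w. step Th A u v \<Longrightarrow> is_term Th w \<Longrightarrow> step Th A (F u w) (F v w)"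
    and 2: "\<And>u v w. step Th A u v \<Longrightarrow> is_term Th w \<Longrightarrow> step Th A (F w u) (F w v)"
  shows "conv Th A (F s s') (F t t')"
proof (rule equivclp_trans)
  show "conv Th A (F s s') (F t s')"
    using assms(1) by (rule conv_lift[where F = "\<lambda>u. F u s'"]) (intro 1 assms)
  show "conv Th A (F t s') (F t t')"
    using assms(2) by (rule conv_lift) (use assms(3) conv_is_term[OF assms(1)] in \<open>auto intro: 2\<close>)
qed

lemma conv_Sign:
  "\<lbrakk>conv Th A s t; conv Th A s' t'; is_term Th s; is_term Th s'\<rbrakk> \<Longrightarrow> conv Th A (Sign s s') (Sign t t')"
  by (rule conv_lift2) (auto simp: step_def intro: rw.intros)

lemma conv_Blind:
  "\<lbrakk>conv Th A s t; conv Th A s' t'; is_term Th s; is_term Th s'\<rbrakk> \<Longrightarrow> conv Th A (Blind s s') (Blind t t')"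
  by (rule conv_lift2) (auto simp: step_def intro: rw.intros)

lemma conv_MPair:
  "\<lbrakk>conv Th A s t; conv Th A s' t'; is_term Th s; is_term Th s'\<rbrakk> \<Longrightarrow> conv Th A (MPair s s') (MPair t t')"
  by (rule conv_lift2) (auto simp: step_def intro: rw.intros)

lemma conv_Enc:
  "\<lbrakk>conv Th A s t; conv Th A s' t'; is_term Th s; is_term Th s'\<rbrakk> \<Longrightarrow> conv Th A (Enc s s') (Enc t t')"
  by (rule conv_lift2) (auto simp: step_def intro: rw.intros)

lemma conv_Fn_arg:
  assumes "conv Th A s t" "is_term Th (Fn f (us @ s # vs))"
  shows "conv Th A (Fn f (us @ s # vs)) (Fn f (us @ t # vs))"
  by (rule conv_lift[OF assms(1), of "\<lambda>u. Fn f (us @ u # vs)"])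
    (use assms(2) in \<open>auto simp: step_def intro: rw.intros\<close>)

lemma conv_Fn:
  assumes "list_all2 (conv Th A) ts us" "is_term Th (Fn f ts)"
  shows "conv Th A (Fn f ts) (Fn f us)"
proof -
  \<comment> \<open>The prefix \<open>ws\<close> collects the arguments that have already been
    replaced.\<close>
  have "conv Th A (Fn f (ws @ ts)) (Fn f (ws @ us))" if "is_term Th (Fn f (ws @ ts))" for ws
    using assms(1) that
  proof (induction ts us arbitrary: ws rule: list_all2_induct)
    case (Cons t ts u us)
    have 1: "conv Th A (Fn f (ws @ t # ts)) (Fn f (ws @ u # ts))"
      using Cons.hyps(1) Cons.prems by (rule conv_Fn_arg)
    then have "is_term Th (Fn f ((ws @ [u]) @ ts))"
      using conv_is_term Cons.prems by fastforce
    from equivclp_trans[OF 1] Cons.IH[OF this] show ?case by simp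
  qed simp
  from this[of "[]"] assms(2) show ?thesis by simp
qed

lemma rw_subst: "rw A s t \<Longrightarrow> rw A (subst \<sigma> s) (subst \<sigma> t)"
proof (induction rule: rw.induct)
  case (root l r \<tau>)
  have "subst \<sigma> (subst \<tau> u) = subst (subst \<sigma> \<circ> \<tau>) u" for u
    by (induction u) auto
  then show ?case using rw.root[OF root] by metis
qed (auto intro: rw.intros)

lemma is_term_subst: "is_term Th t \<Longrightarrow> (\<And>x. is_term Th (\<sigma> x)) \<Longrightarrow> is_term Th (subst \<sigma> t)"
  by (induction t) auto

lemma step_subst:
  "step Th A s t \<Longrightarrow> (\<And>x. is_term Th (\<sigma> x)) \<Longrightarrow> step Th A (subst \<sigma> s) (subst \<sigma> t)"
  by (auto simp: step_def intro: rw_subst is_term_subst)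

lemma conv_subst:
  "conv Th A s t \<Longrightarrow> (\<And>x. is_term Th (\<sigma> x)) \<Longrightarrow> conv Th A (subst \<sigma> s) (subst \<sigma> t)"
  by (rule conv_lift) (auto intro: step_subst)

section \<open>Rewriting modulo AC under substitutions and contexts\<close>

lemma red_subst:
  "red Th R s t \<Longrightarrow> (\<And>x. is_term Th (\<sigma> x)) \<Longrightarrow> red Th R (subst \<sigma> s) (subst \<sigma> t)"
  unfolding red_def eqAC_def by (metis conv_subst step_subst)

lemma red_lift:
  assumes "red Th R s t" and "\<And>A u v. step Th A u v \<Longrightarrow> step Th A (F u) (F v)"
  shows "red Th R (F s) (F t)"
  using assms unfolding red_def eqAC_def by (metis conv_lift)

lemma red_eqAC: "eqAC Th s s' \<Longrightarrow> red Th R s' t \<Longrightarrow> red Th R s t"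
  unfolding red_def eqAC_def by (meson equivclp_trans)

lemma normal_eqAC: "eqAC Th s t \<Longrightarrow> normal Th R s \<Longrightarrow> normal Th R t"
  unfolding normal_def by (metis eqAC_def equivclp_sym red_eqAC)

lemma subterms_refl: "t \<in> subterms t"
  by (cases t) auto

lemma is_term_subterms: "u \<in> subterms t \<Longrightarrow> is_term Th t \<Longrightarrow> is_term Th u"
  by (induction t) auto

lemma ground_subterms: "u \<in> subterms t \<Longrightarrow> ground t \<Longrightarrow> ground u"
  by (induction t) auto

lemma size_arg: "t \<in> set ts \<Longrightarrow> size t < size (Fn f ts)"
  by (simp add: less_Suc_eq_le size_list_estimation')

lemma size_subterms: "u \<in> subterms t \<Longrightarrow> size u \<le> size t"
proof (induction t)
  case (Fn f ts)
  show ?case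
  proof (cases "u = Fn f ts")
    case False
    with Fn.prems obtain t where "t \<in> set ts" "u \<in> subterms t" by auto
    with Fn.IH[of t] size_arg[of t ts f] show ?thesis by simp
  qed simp
qed auto

text \<open>A reduction of an argument lifts to the whole term. Well-formedness of the whole term is
  what turns the lifted rewrite into a \<open>step\<close>.\<close>

lemma normal_subterms:
  assumes "u \<in> subterms t" "is_term Th t" "normal Th R t"
  shows "normal Th R u"
  using assms
proof (induction t)
  case (Pub M)
  have "normal Th R M"
    using Pub.prems unfolding normal_def
    by (auto dest!: red_lift[of Th R M _ Pub] simp: step_def intro: rw.intros)
  with Pub show ?case by auto
next
  case (Sign M K)
  have "normal Th R M" "normal Th R K"
    using Sign.prems unfolding normal_def
    by (auto dest!: red_lift[of Th R M _ "\<lambda>u. Sign u K"] red_lift[of Th R K _ "Sign M"]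
        simp: step_def intro: rw.intros)
  with Sign show ?case by auto
next
  case (Blind M K)
  have "normal Th R M" "normal Th R K"
    using Blind.prems unfolding normal_def
    by (auto dest!: red_lift[of Th R M _ "\<lambda>u. Blind u K"] red_lift[of Th R K _ "Blind M"]
        simp: step_def intro: rw.intros)
  with Blind show ?case by auto
next
  case (MPair M K)
  have "normal Th R M" "normal Th R K"
    using MPair.prems unfolding normal_def
    by (auto dest!: red_lift[of Th R M _ "\<lambda>u. MPair u K"] red_lift[of Th R K _ "MPair M"]
        simp: step_def intro: rw.intros)
  with MPair show ?case by auto
next
  case (Enc M K)
  have "normal Th R M" "normal Th R K"
    using Enc.prems unfolding normal_def
    by (auto dest!: red_lift[of Th R M _ "\<lambda>u. Enc u K"] red_lift[of Th R K _ "Enc M"]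
        simp: step_def intro: rw.intros)
  with Enc show ?case by auto
next
  case (Fn f ts)
  have "normal Th R s" if "s \<in> set ts" for s
  proof -
    obtain us vs where ts: "ts = us @ s # vs"
      using \<open>s \<in> set ts\<close> by (meson split_list)
    show ?thesis
      using Fn.prems unfolding normal_def ts
      by (auto dest!: red_lift[of Th R s _ "\<lambda>u. Fn f (us @ u # vs)"]
          simp: step_def intro: rw.intros)
  qed
  with Fn show ?case by auto
qed auto

section \<open>Equality modulo AC\<close>

fun mvars :: "('f, 'n) msg \<Rightarrow> nat set" where
  "mvars (Var x) = {x}"
| "mvars (Name a) = {}"
| "mvars (Pub M) = mvars M"
| "mvars (Sign M K) = mvars M \<union> mvars K"
| "mvars (Blind M K) = mvars M \<union> mvars K"
| "mvars (MPair M N) = mvars M \<union> mvars N"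
| "mvars (Enc M K) = mvars M \<union> mvars K"
| "mvars (Fn f ts) = (\<Union>t\<in>set ts. mvars t)"

lemma ground_iff_mvars: "ground t \<longleftrightarrow> mvars t = {}"
  by (induction t) auto

lemma subst_ground: "ground t \<Longrightarrow> subst \<sigma> t = t"
  by (induction t) (auto intro: map_idI)

lemma all_ac_axiomsE:
  assumes "(l, r) \<in> all_ac_axioms Th"
  obtains p where
    "l = Fn p [Var 0, Var 1]" "r = Fn p [Var 1, Var 0]"
  | p where
    "l = Fn p [Fn p [Var 0, Var 1], Var 2]" "r = Fn p [Var 0, Fn p [Var 1, Var 2]]"
  using assms by (auto simp: all_ac_axioms_def ac_axioms_def)

text \<open>In both AC axioms the two sides contain the same variables, each once, and the same
  number of occurrences of \<open>p\<close>. Hence size is a measure on AC classes.\<close>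

lemma rw_AC_size: "rw (all_ac_axioms Th) s t \<Longrightarrow> size s = size t"
  by (induction rule: rw.induct) (auto elim!: all_ac_axiomsE)

lemma eqAC_size: "eqAC Th s t \<Longrightarrow> size s = size t"
  unfolding eqAC_def by (induction rule: equivclp_induct) (auto simp: step_def dest: rw_AC_size)

lemma rw_AC_mvars: "rw (all_ac_axioms Th) s t \<Longrightarrow> mvars s = mvars t"
  by (induction rule: rw.induct) (auto elim!: all_ac_axiomsE)

text \<open>This makes groundness invariant under AC, and it separates terms that contain different
  variables.\<close>

lemma eqAC_mvars: "eqAC Th s t \<Longrightarrow> mvars s = mvars t"
  unfolding eqAC_def by (induction rule: equivclp_induct) (auto simp: step_def dest: rw_AC_mvars)

lemma rw_AC_alien: "rw (all_ac_axioms Th) s t \<Longrightarrow> alien Th i s \<longleftrightarrow> alien Th i t"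
  by (induction rule: rw.induct) (auto elim!: all_ac_axiomsE simp: alien_def)

lemma eqAC_refl [simp]: "eqAC Th t t"
  by (simp add: eqAC_def)

lemma eqAC_sym: "eqAC Th s t \<Longrightarrow> eqAC Th t s"
  unfolding eqAC_def by (rule equivclp_sym)

lemma eqAC_trans: "eqAC Th s t \<Longrightarrow> eqAC Th t u \<Longrightarrow> eqAC Th s u"
  unfolding eqAC_def by (rule equivclp_trans)

lemma step_eqAC: "step Th (all_ac_axioms Th) s t \<Longrightarrow> eqAC Th s t"
  unfolding eqAC_def by (rule r_into_equivclp)

text \<open>An induction invariant for inverting AC-equality below a constructor: no AC axiom
  applies at a constructor, so the arguments are related pairwise. The remaining heads need no
  inversion, hence the value \<open>True\<close>.\<close>

fun eqAC_args :: "('f, 'n) comb \<Rightarrow> ('f, 'n) msg \<Rightarrow> ('f, 'n) msg \<Rightarrow> bool" where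
  "eqAC_args Th (Pub M) t = (\<exists>M'. t = Pub M' \<and> eqAC Th M M')"
| "eqAC_args Th (Sign M K) t = (\<exists>M' K'. t = Sign M' K' \<and> eqAC Th M M' \<and> eqAC Th K K')"
| "eqAC_args Th (Blind M K) t = (\<exists>M' K'. t = Blind M' K' \<and> eqAC Th M M' \<and> eqAC Th K K')"
| "eqAC_args Th (MPair M K) t = (\<exists>M' K'. t = MPair M' K' \<and> eqAC Th M M' \<and> eqAC Th K K')"
| "eqAC_args Th (Enc M K) t = (\<exists>M' K'. t = Enc M' K' \<and> eqAC Th M M' \<and> eqAC Th K K')"
| "eqAC_args Th s t = True"

lemma eqAC_args_refl: "eqAC_args Th t t"
  by (cases t) auto

lemma eqAC_args_trans: "eqAC_args Th s t \<Longrightarrow> eqAC_args Th t u \<Longrightarrow> eqAC_args Th s u"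
  by (cases s) (auto, (metis eqAC_trans)+)

text \<open>Both directions are recorded because the closure \<open>equivclp\<close> traverses steps
  backwards as well.\<close>

lemma step_AC_args:
  assumes "step Th (all_ac_axioms Th) s t"
  shows "eqAC_args Th s t \<and> eqAC_args Th t s"
proof -
  have "rw (all_ac_axioms Th) s t" "is_term Th s" "is_term Th t"
    using assms by (auto simp: step_def)
  then show ?thesis
    by (cases rule: rw.cases)
      (auto elim: all_ac_axiomsE intro: step_eqAC eqAC_sym[OF step_eqAC] simp: step_def)
qed

lemma eqAC_imp_args: "eqAC Th s t \<Longrightarrow> eqAC_args Th s t"
  unfolding eqAC_def
  by (induction rule: equivclp_induct)
    (auto simp: eqAC_args_refl dest: step_AC_args intro: eqAC_args_trans)

lemma eqAC_Pub: "eqAC Th (Pub M) t \<Longrightarrow> \<exists>M'. t = Pub M' \<and> eqAC Th M M'"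
  and eqAC_Sign: "eqAC Th (Sign M K) t \<Longrightarrow> \<exists>M' K'. t = Sign M' K' \<and> eqAC Th M M' \<and> eqAC Th K K'"
  and eqAC_Blind: "eqAC Th (Blind M K) t \<Longrightarrow> \<exists>M' K'. t = Blind M' K' \<and> eqAC Th M M' \<and> eqAC Th K K'"
  and eqAC_MPair: "eqAC Th (MPair M K) t \<Longrightarrow> \<exists>M' K'. t = MPair M' K' \<and> eqAC Th M M' \<and> eqAC Th K K'"
  and eqAC_Enc: "eqAC Th (Enc M K) t \<Longrightarrow> \<exists>M' K'. t = Enc M' K' \<and> eqAC Th M M' \<and> eqAC Th K K'"
  by (auto dest: eqAC_imp_args)

section \<open>Factors under AC-equality\<close>

fun factors :: "('f, 'n) comb \<Rightarrow> nat \<Rightarrow> ('f, 'n) msg \<Rightarrow> ('f, 'n) msg set" where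
  "factors Th i (Pub M) = factors Th i M"
| "factors Th i (Sign M K) = factors Th i M \<union> factors Th i K"
| "factors Th i (Blind M K) = factors Th i M \<union> factors Th i K"
| "factors Th i (MPair M K) = factors Th i M \<union> factors Th i K"
| "factors Th i (Enc M K) = factors Th i M \<union> factors Th i K"
| "factors Th i (Fn f ts) =
     (if f \<in> sig_of Th i then {t \<in> set ts. alien Th i t} else {}) \<union> (\<Union>t\<in>set ts. factors Th i t)"
| "factors Th i t = {}"

lemma factor_iff: "factor Th i A N \<longleftrightarrow> A \<in> factors Th i N"
proof (induction N)
  case (Fn f ts)
  have "factor Th i A (Fn f ts) \<longleftrightarrow>
      f \<in> sig_of Th i \<and> A \<in> set ts \<and> alien Th i A \<or> (\<exists>t\<in>set ts. factor Th i A t)"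
    unfolding factor_def by auto
  with Fn show ?case by auto
qed (auto simp: factor_def)

lemma factor_size: "factor Th i A N \<Longrightarrow> size A < size N"
  unfolding factor_def using size_arg size_subterms by (metis order_less_le_trans)

lemma rel_set_eqAC_refl: "rel_set (eqAC Th) S S"
  using eqAC_refl by (blast intro: rel_setI)

lemma rel_set_Un: "rel_set P A B \<Longrightarrow> rel_set P C D \<Longrightarrow> rel_set P (A \<union> C) (B \<union> D)"
  unfolding rel_set_def by blast

text \<open>At the root the two factor sets coincide: in the theory of \<open>p\<close> an inner
  \<open>p\<close> is not alien, so reassociating keeps the same aliens. Below a symbol of the
  theory the rewritten argument may itself be a factor; it stays alien and changes only modulo
  AC.\<close>

lemma step_AC_factors:
  assumes "step Th (all_ac_axioms Th) s t"
  shows "rel_set (eqAC Th) (factors Th i s) (factors Th i t)"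
proof -
  have "rw (all_ac_axioms Th) s t" "is_term Th s" "is_term Th t"
    using assms by (auto simp: step_def)
  then show ?thesis
  proof (induction rule: rw.induct)
    case (root l r \<sigma>)
    from root(1) have "factors Th i (subst \<sigma> l) = factors Th i (subst \<sigma> r)"
      by (cases rule: all_ac_axiomsE) (auto simp: alien_def)
    then show ?case using rel_set_eqAC_refl by metis
  next
    case (fn s t f us vs)
    have st: "eqAC Th s t" using fn by (auto intro!: step_eqAC simp: step_def)
    \<comment> \<open>The contribution of the rewritten argument \<open>u\<close> is isolated from
      that of its siblings.\<close>
    have split: "factors Th i (Fn f (us @ u # vs)) =
        (if f \<in> sig_of Th i then {v \<in> set us \<union> set vs. alien Th i v} else {}) \<union>
        (\<Union>v\<in>set us \<union> set vs. factors Th i v) \<union>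
        (if f \<in> sig_of Th i \<and> alien Th i u then {u} else {}) \<union> factors Th i u" for u
      by auto
    show ?case
      unfolding split using fn st rw_AC_alien[OF fn.hyps, of i]
      by (intro rel_set_Un rel_set_eqAC_refl) (auto simp: rel_set_def)
  qed (auto intro: rel_set_Un rel_set_eqAC_refl)
qed

lemma eqAC_factor:
  assumes "eqAC Th s t" "factor Th i A s"
  shows "\<exists>B. factor Th i B t \<and> eqAC Th A B"
  using assms(1)[unfolded eqAC_def]
proof (induction rule: equivclp_induct)
  case base
  then show ?case using assms(2) eqAC_refl by blast
next
  case (step y z)
  then show ?case
    unfolding factor_iff
    by (meson step_AC_factors[THEN rel_setD1] step_AC_factors[THEN rel_setD2] eqAC_sym eqAC_trans)
qed

section \<open>Layers\<close>

text \<open>A term splits into its top layer over one signature and the alien subterms below it.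
  \<open>hat\<close> acts on the latter, leaving the layer unchanged.\<close>

fun hat :: "('f, 'n) comb \<Rightarrow> (('f, 'n) msg \<Rightarrow> ('f, 'n) msg) \<Rightarrow> nat \<Rightarrow> ('f, 'n) msg \<Rightarrow> ('f, 'n) msg" where
  "hat Th \<rho> i (Fn f ts) = (if f \<in> sig_of Th i then Fn f (map (hat Th \<rho> i) ts) else \<rho> (Fn f ts))"
| "hat Th \<rho> i t = \<rho> t"

fun aliens :: "('f, 'n) comb \<Rightarrow> nat \<Rightarrow> ('f, 'n) msg \<Rightarrow> ('f, 'n) msg set" where
  "aliens Th i (Fn f ts) = (if f \<in> sig_of Th i then \<Union>t\<in>set ts. aliens Th i t else {Fn f ts})"
| "aliens Th i t = {t}"

lemma alien_simps [simp]:
  "alien Th i (Var x)" "alien Th i (Name a)" "alien Th i (Pub M)" "alien Th i (Sign M K)"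
  "alien Th i (Blind M K)" "alien Th i (MPair M K)" "alien Th i (Enc M K)"
  "alien Th i (Fn f ts) \<longleftrightarrow> f \<notin> sig_of Th i"
  by (auto simp: alien_def)

lemma hat_alien: "alien Th i t \<Longrightarrow> hat Th \<rho> i t = \<rho> t"
  by (cases t) auto

lemma aliens_alien: "alien Th i t \<Longrightarrow> aliens Th i t = {t}"
  by (cases t) auto

lemma alien_aliens: "a \<in> aliens Th i t \<Longrightarrow> alien Th i a"
  by (induction t) (auto split: if_splits)

lemma aliens_subterms: "a \<in> aliens Th i t \<Longrightarrow> a \<in> subterms t"
  by (induction t) (auto split: if_splits)

lemma finite_aliens: "finite (aliens Th i t)"
  by (induction t) auto

text \<open>An alien other than the whole term hangs directly below a symbol of the top layer. This
  connects layers with the side condition of \<open>acut\<close>.\<close>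

lemma aliens_factor: "a \<in> aliens Th i t \<Longrightarrow> a = t \<or> factor Th i a t"
proof (induction t)
  case (Fn f ts)
  show ?case
  proof (cases "f \<in> sig_of Th i")
    case True
    with Fn.prems obtain t where t: "t \<in> set ts" "a \<in> aliens Th i t" by auto
    from Fn.IH[OF t] t True alien_aliens[OF t(2)] show ?thesis
      by (auto simp: factor_iff)
  qed (use Fn.prems in auto)
qed auto

lemma hat_cong: "(\<And>a. a \<in> aliens Th i t \<Longrightarrow> \<rho> a = \<rho>' a) \<Longrightarrow> hat Th \<rho> i t = hat Th \<rho>' i t"
proof (induction t)
  case (Fn f ts)
  have "hat Th \<rho> i t = hat Th \<rho>' i t" if "t \<in> set ts" "f \<in> sig_of Th i" for t
    by (rule Fn.IH) (use that Fn.prems in auto)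
  with Fn.prems show ?case by auto
qed auto

lemma hat_id: "(\<And>a. a \<in> aliens Th i t \<Longrightarrow> \<rho> a = a) \<Longrightarrow> hat Th \<rho> i t = t"
proof (induction t)
  case (Fn f ts)
  have "hat Th \<rho> i t = t" if "t \<in> set ts" "f \<in> sig_of Th i" for t
    by (rule Fn.IH) (use that Fn.prems in auto)
  with Fn.prems show ?case by (auto intro: map_idI)
qed auto

lemma hat_hat: "hat Th \<rho> i (hat Th \<rho>' i t) = hat Th (\<lambda>a. hat Th \<rho> i (\<rho>' a)) i t"
  by (induction t) auto

lemma aliens_hat: "aliens Th i (hat Th \<rho> i t) = (\<Union>a\<in>aliens Th i t. aliens Th i (\<rho> a))"
  by (induction t) auto

lemma mvars_hat: "mvars (hat Th \<rho> i t) = (\<Union>a\<in>aliens Th i t. mvars (\<rho> a))"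
  by (induction t) auto

lemma is_term_aliens: "is_term Th t \<Longrightarrow> a \<in> aliens Th i t \<Longrightarrow> is_term Th a"
  using aliens_subterms is_term_subterms by blast

lemma is_term_hat:
  "is_term Th t \<Longrightarrow> (\<And>a. a \<in> aliens Th i t \<Longrightarrow> is_term Th (\<rho> a)) \<Longrightarrow> is_term Th (hat Th \<rho> i t)"
proof (induction t)
  case (Fn f ts)
  have "is_term Th (hat Th \<rho> i t)" if "t \<in> set ts" "f \<in> sig_of Th i" for t
    by (rule Fn.IH) (use that Fn.prems in auto)
  with Fn.prems show ?case by auto
qed auto

text \<open>All symbols of \<open>l\<close> belong to the layer, so \<open>hat\<close> reaches only
  the images of the variables. Instances of axioms therefore stay instances of axioms.\<close>

lemma hat_subst:
  "l \<in> terms_over Th (sig_of Th i) \<Longrightarrow> hat Th \<rho> i (subst \<sigma> l) = subst (\<lambda>x. hat Th \<rho> i (\<sigma> x)) l"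
  by (induction rule: terms_over.induct) auto

lemma subst_hat: "subst \<sigma> (hat Th \<rho> i t) = hat Th (\<lambda>a. subst \<sigma> (\<rho> a)) i t"
  by (induction t) auto

lemma conv_hat:
  assumes "is_term Th t" "\<And>a. a \<in> aliens Th i t \<Longrightarrow> is_term Th (\<rho> a) \<and> conv Th A (\<rho> a) (\<rho>' a)"
  shows "conv Th A (hat Th \<rho> i t) (hat Th \<rho>' i t)"
  using assms
proof (induction t)
  case (Fn f ts)
  show ?case
  proof (cases "f \<in> sig_of Th i")
    case True
    have "list_all2 (conv Th A) (map (hat Th \<rho> i) ts) (map (hat Th \<rho>' i) ts)"
      using Fn True by (auto simp: list.rel_map intro!: list.rel_refl_strong)
    moreover have "is_term Th (hat Th \<rho> i (Fn f ts))"
      using Fn.prems by (blast intro: is_term_hat)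
    ultimately show ?thesis using True by (auto intro: conv_Fn)
  qed (use Fn.prems in auto)
qed auto

text \<open>The fillings with members of \<open>S\<close> of the contexts in rule \<open>id\<close>.\<close>

inductive_set layer :: "('f, 'n) comb \<Rightarrow> nat \<Rightarrow> ('f, 'n) msg set \<Rightarrow> ('f, 'n) msg set"
  for Th :: "('f, 'n) comb" and i :: nat and S :: "('f, 'n) msg set" where
  base: "s \<in> S \<Longrightarrow> s \<in> layer Th i S"
| fn: "f \<in> sig_of Th i \<Longrightarrow> length ts = arity Th f \<Longrightarrow> (\<And>t. t \<in> set ts \<Longrightarrow> t \<in> layer Th i S)
     \<Longrightarrow> Fn f ts \<in> layer Th i S"

lemma fill_list_layer:
  assumes "\<And>c Ms. c \<in> set cs \<Longrightarrow> length Ms = holes c \<Longrightarrow> set Ms \<subseteq> S \<Longrightarrow> fill c Ms \<in> layer Th i S"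
    and "length Ms = sum_list (map holes cs)" "set Ms \<subseteq> S"
  shows "length (fill_list cs Ms) = length cs \<and> set (fill_list cs Ms) \<subseteq> layer Th i S"
  using assms
proof (induction cs arbitrary: Ms)
  case (Cons c cs)
  have "fill c (take (holes c) Ms) \<in> layer Th i S"
    by (rule Cons.prems(1)) (use Cons.prems(2,3) set_take_subset[of "holes c" Ms] in auto)
  moreover have "length (fill_list cs (drop (holes c) Ms)) = length cs \<and>
      set (fill_list cs (drop (holes c) Ms)) \<subseteq> layer Th i S"
    by (rule Cons.IH) (use Cons.prems set_drop_subset[of "holes c" Ms] in auto)
  ultimately show ?case by simp
qed simp

lemma fill_layer:
  "C \<in> ctxs Th i \<Longrightarrow> length Ms = holes C \<Longrightarrow> set Ms \<subseteq> S \<Longrightarrow> fill C Ms \<in> layer Th i S"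
proof (induction arbitrary: Ms rule: ctxs.induct)
  case 1
  then show ?case by (cases Ms) (auto intro: layer.base)
next
  case (2 f cs)
  have "length (fill_list cs Ms) = length cs \<and> set (fill_list cs Ms) \<subseteq> layer Th i S"
    using 2 by (intro fill_list_layer) auto
  with 2 show ?case by (auto intro: layer.fn)
qed

lemma layer_fill:
  "t \<in> layer Th i S \<Longrightarrow> \<exists>C Ms. C \<in> ctxs Th i \<and> length Ms = holes C \<and> set Ms \<subseteq> S \<and> fill C Ms = t"
proof (induction rule: layer.induct)
  case (base s)
  then show ?case by (intro exI[of _ Hole] exI[of _ "[s]"]) (auto intro: ctxs.intros)
next
  case (fn f ts)
  \<comment> \<open>The statement is proved for lists of arguments, so that the fillings of the
    argument contexts can be concatenated in hole order.\<close>
  have "\<exists>cs Ms. length cs = length us \<and> set cs \<subseteq> ctxs Th i \<and> length Ms = sum_list (map holes cs) \<and>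
      set Ms \<subseteq> S \<and> fill_list cs Ms = us" if "set us \<subseteq> set ts" for us
    using that
  proof (induction us)
    case (Cons u us)
    then obtain cs Ms where 1: "length cs = length us" "set cs \<subseteq> ctxs Th i"
      "length Ms = sum_list (map holes cs)" "set Ms \<subseteq> S" "fill_list cs Ms = us"
      by auto
    from Cons.prems fn.IH obtain C Ns where
      "C \<in> ctxs Th i" "length Ns = holes C" "set Ns \<subseteq> S" "fill C Ns = u"
      by (metis insert_subset list.simps(15))
    with 1 show ?case by (intro exI[of _ "C # cs"] exI[of _ "Ns @ Ms"]) auto
  qed auto
  then obtain cs Ms where "length cs = length ts" "set cs \<subseteq> ctxs Th i"
    "length Ms = sum_list (map holes cs)" "set Ms \<subseteq> S" "fill_list cs Ms = ts"
    by blast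
  with fn.hyps show ?case
    by (intro exI[of _ "CFn f cs"] exI[of _ Ms]) (auto intro!: ctxs.intros)
qed

lemma layer_mono: "t \<in> layer Th i S \<Longrightarrow> S \<subseteq> S' \<Longrightarrow> t \<in> layer Th i S'"
  by (induction rule: layer.induct) (auto intro: layer.intros)

lemma layer_aliens: "t \<in> layer Th i S \<Longrightarrow> a \<in> aliens Th i t \<Longrightarrow> \<exists>s\<in>S. a \<in> aliens Th i s"
  by (induction rule: layer.induct) (auto split: if_splits)

lemma layer_is_term:
  "t \<in> layer Th i S \<Longrightarrow> sig_of Th i \<subseteq> sigE Th \<Longrightarrow> (\<And>s. s \<in> S \<Longrightarrow> is_term Th s) \<Longrightarrow> is_term Th t"
  by (induction rule: layer.induct) auto

text \<open>Variables and names are alien to every theory, so a term without aliens is a context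
  without holes.\<close>

lemma layer_pure: "is_term Th t \<Longrightarrow> aliens Th i t = {} \<Longrightarrow> t \<in> layer Th i S"
  by (induction t) (auto split: if_splits intro!: layer.fn)

lemma layer_hat:
  "t \<in> layer Th i S \<Longrightarrow> (\<And>s. s \<in> S \<Longrightarrow> hat Th \<rho> i s \<in> layer Th i S') \<Longrightarrow> hat Th \<rho> i t \<in> layer Th i S'"
  by (induction rule: layer.induct) (auto intro!: layer.fn)

lemma layer_conv:
  assumes "t \<in> layer Th i S" "is_term Th t" "\<And>s. s \<in> S \<Longrightarrow> \<exists>u\<in>layer Th i S'. conv Th A s u"
  shows "\<exists>u\<in>layer Th i S'. conv Th A t u"
  using assms
proof (induction rule: layer.induct)
  case (fn f ts)
  then have "\<forall>t\<in>set ts. \<exists>u. u \<in> layer Th i S' \<and> conv Th A t u"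
    by (metis is_term.simps(8))
  then obtain u where u: "\<And>t. t \<in> set ts \<Longrightarrow> u t \<in> layer Th i S' \<and> conv Th A t (u t)" by metis
  then have "list_all2 (conv Th A) ts (map u ts)"
    by (auto simp: list.rel_map intro!: list.rel_refl_strong)
  with fn.prems have "conv Th A (Fn f ts) (Fn f (map u ts))" by (blast intro: conv_Fn)
  moreover have "Fn f (map u ts) \<in> layer Th i S'"
    by (rule layer.fn) (use fn.hyps u in auto)
  ultimately show ?case by blast
qed auto

section \<open>Equality in one component theory\<close>

text \<open>Equality with respect to \<open>axs Th i\<close> where alien subterms are treated as atoms.\<close>

inductive lequiv :: "('f, 'n) comb \<Rightarrow> nat \<Rightarrow> ('f, 'n) msg \<Rightarrow> ('f, 'n) msg \<Rightarrow> bool"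
  for Th :: "('f, 'n) comb" and i :: nat where
  refl: "lequiv Th i t t"
| sym: "lequiv Th i s t \<Longrightarrow> lequiv Th i t s"
| trans: "lequiv Th i s t \<Longrightarrow> lequiv Th i t u \<Longrightarrow> lequiv Th i s u"
| ax: "(l, r) \<in> axs Th i \<Longrightarrow> is_term Th (subst \<sigma> l) \<Longrightarrow> is_term Th (subst \<sigma> r)
    \<Longrightarrow> lequiv Th i (subst \<sigma> l) (subst \<sigma> r)"
| arg: "f \<in> sig_of Th i \<Longrightarrow> lequiv Th i s t \<Longrightarrow> lequiv Th i (Fn f (us @ s # vs)) (Fn f (us @ t # vs))"

lemma lequiv_Fn:
  assumes "f \<in> sig_of Th i" "list_all2 (lequiv Th i) ts us"
  shows "lequiv Th i (Fn f ts) (Fn f us)"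
proof -
  have "lequiv Th i (Fn f (ws @ ts)) (Fn f (ws @ us))" for ws
    using assms(2)
  proof (induction ts us arbitrary: ws rule: list_all2_induct)
    case (Cons t ts u us)
    from lequiv.arg[OF assms(1) Cons.hyps(1), of ws ts] Cons.IH[of "ws @ [u]"] show ?case
      by (auto intro: lequiv.trans)
  qed (simp add: lequiv.refl)
  from this[of "[]"] show ?thesis by simp
qed

lemma lequiv_is_term: "lequiv Th i s t \<Longrightarrow> is_term Th s \<longleftrightarrow> is_term Th t"
  by (induction rule: lequiv.induct) auto

lemma lequiv_eqE:
  assumes "lequiv Th i s t" "i \<in> {1..num Th}" "is_term Th s"
  shows "eqE Th s t"
  using assms
proof (induction rule: lequiv.induct)
  case (sym s t)
  then show ?case
    unfolding eqE_def by (metis equivclp_sym lequiv_is_term)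
next
  case (trans s t u)
  then show ?case
    unfolding eqE_def by (metis equivclp_trans lequiv_is_term)
next
  case (ax l r \<sigma>)
  then have "step Th (axsE Th) (subst \<sigma> l) (subst \<sigma> r)"
    unfolding step_def axsE_def by (blast intro: rw.root)
  then show ?case unfolding eqE_def by blast
next
  case (arg f s t us vs)
  then show ?case unfolding eqE_def by (intro conv_Fn_arg) auto
qed (simp add: eqE_def)

lemma terms_over_is_term: "t \<in> terms_over Th S \<Longrightarrow> S \<subseteq> sigE Th \<Longrightarrow> is_term Th t"
  by (induction rule: terms_over.induct) auto

section \<open>Unique normal forms and consistency\<close>

locale combination =
  fixes Th :: "('f, 'n) comb" and R :: "('f, 'n) eqns"
  assumes disjoint: "disjoint_combination Th"
    and presents: "presents Th R"
    and terminating: "terminating_AC Th R"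
    and confluent: "confluent_AC Th R"
begin

abbreviation ix :: "nat set" where "ix \<equiv> {1..num Th}"

lemma sig_of_unique: "\<lbrakk>i \<in> ix; j \<in> ix; f \<in> sig_of Th i; f \<in> sig_of Th j\<rbrakk> \<Longrightarrow> i = j"
  using disjoint unfolding disjoint_combination_def by blast

lemma sig_of_sigE: "i \<in> ix \<Longrightarrow> sig_of Th i \<subseteq> sigE Th"
  unfolding sigE_def by blast

lemma axs_terms_over:
  "\<lbrakk>(l, r) \<in> axs Th i; i \<in> ix\<rbrakk> \<Longrightarrow> l \<in> terms_over Th (sig_of Th i) \<and> r \<in> terms_over Th (sig_of Th i)"
  using disjoint unfolding disjoint_combination_def by blast

text \<open>Such a rule would rewrite every term, and iterating it would contradict
  termination.\<close>

lemma rule_lhs_not_Var: "(Var x, r) \<notin> R"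
proof
  assume r: "(Var x, r) \<in> R"
  \<comment> \<open>Each term is \<open>r\<close> with all variables replaced by the previous term,
    starting from \<open>Var 0\<close>.\<close>
  define t :: "nat \<Rightarrow> ('f, 'n) msg" where "t = rec_nat (Var 0) (\<lambda>_ u. subst (\<lambda>_. u) r)"
  have t: "t (Suc k) = subst (\<lambda>_. t k) r" for k
    by (simp add: t_def)
  have "is_term Th r"
    using r presents unfolding presents_def by (blast intro: terms_over_is_term)
  then have "is_term Th (t k)" for k
    by (induction k) (auto simp: t is_term_subst, simp add: t_def)
  then have "step Th R (t k) (t (Suc k))" for k
    using rw.root[OF r, of "\<lambda>_. t k"] unfolding step_def by (simp add: t[symmetric])
  then have "red Th R (t k) (t (Suc k))" for k
    unfolding red_def using eqAC_refl by blast
  then show False using terminating unfolding terminating_AC_def by blast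
qed

text \<open>The AC class of a variable is a singleton and no rule applies to a variable. Hence
  distinct variables are never equal modulo \<open>E\<close>, which is the consistency exploited
  below.\<close>

lemma normal_Var: "normal Th R (Var x)"
proof -
  have "s = Var x" if "eqAC Th (Var x) s" for s
  proof -
    have "u \<noteq> Var x \<and> v \<noteq> Var x" if "rw (all_ac_axioms Th) u v" for u v
      using that by (induction rule: rw.induct) (auto elim: all_ac_axiomsE)
    then have step: "\<not> step Th (all_ac_axioms Th) (Var x) v \<and> \<not> step Th (all_ac_axioms Th) v (Var x)" for v
      by (auto simp: step_def)
    from that show ?thesis
      unfolding eqAC_def by (induction rule: equivclp_induct) (auto simp: step)
  qed
  moreover have "\<not> rw R (Var x) t" for t
  proof
    assume "rw R (Var x) t"
    then show False
    proof (cases rule: rw.cases)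
      case (root l r \<sigma>)
      then show False using rule_lhs_not_Var by (cases l) auto
    qed
  qed
  ultimately show ?thesis unfolding normal_def red_def step_def by blast
qed

lemma red_rtranclp_eqAC:
  assumes "(red Th R)\<^sup>*\<^sup>* s t" "eqAC Th s' s"
  shows "\<exists>t'. (red Th R)\<^sup>*\<^sup>* s' t' \<and> eqAC Th t' t"
  using assms(1)
proof (cases rule: converse_rtranclpE)
  case base
  then show ?thesis using assms(2) by blast
next
  case (step u)
  then show ?thesis
    by (meson red_eqAC[OF assms(2)] converse_rtranclp_into_rtranclp eqAC_refl)
qed

text \<open>Induction along the conversion. A forward reduction is joined by confluence, a backward
  one is prepended, and an AC step is absorbed into the first reduction from the new term.\<close>

lemma church_rosser:
  assumes "eqE Th s t"
  shows "\<exists>v w. (red Th R)\<^sup>*\<^sup>* s v \<and> (red Th R)\<^sup>*\<^sup>* t w \<and> eqAC Th v w"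
proof -
  have "conv Th (R \<union> all_ac_axioms Th) s t"
    using assms presents unfolding presents_def by simp
  then show ?thesis
  proof (induction rule: equivclp_induct)
    case base
    then show ?case using eqAC_refl by blast
  next
    case (step t u)
    have split: "rw (R \<union> all_ac_axioms Th) x y \<Longrightarrow> rw R x y \<or> rw (all_ac_axioms Th) x y" for x y
      by (induction rule: rw.induct) (auto intro: rw.intros)
    then have split': "step Th (R \<union> all_ac_axioms Th) x y \<Longrightarrow> red Th R x y \<or> eqAC Th x y" for x y
      unfolding red_def using eqAC_refl step_eqAC by (fastforce simp: step_def)
    from step.IH obtain v w where 1: "(red Th R)\<^sup>*\<^sup>* s v" "(red Th R)\<^sup>*\<^sup>* t w" "eqAC Th v w"
      by blast
    consider "red Th R t u" | "red Th R u t" | "eqAC Th t u"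
      using step.hyps(2) split' eqAC_sym by blast
    then show ?case
    proof cases
      case 1
      with \<open>(red Th R)\<^sup>*\<^sup>* t w\<close> confluent obtain w' u' where
        "(red Th R)\<^sup>*\<^sup>* w w'" "(red Th R)\<^sup>*\<^sup>* u u'" "eqAC Th w' u'"
        unfolding confluent_AC_def by (metis r_into_rtranclp)
      moreover obtain v' where "(red Th R)\<^sup>*\<^sup>* v v'" "eqAC Th v' w'"
        using red_rtranclp_eqAC calculation(1) \<open>eqAC Th v w\<close> by blast
      ultimately show ?thesis
        using \<open>(red Th R)\<^sup>*\<^sup>* s v\<close> by (meson eqAC_trans rtranclp_trans)
    next
      case 2
      with 1 show ?thesis by (meson converse_rtranclp_into_rtranclp)
    next
      case 3
      with 1 show ?thesis by (meson red_rtranclp_eqAC eqAC_sym eqAC_trans)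
    qed
  qed
qed

lemma normal_eqE_eqAC:
  assumes "eqE Th s t" "normal Th R s" "normal Th R t"
  shows "eqAC Th s t"
proof -
  from church_rosser[OF assms(1)] obtain v w where
    1: "(red Th R)\<^sup>*\<^sup>* s v" "(red Th R)\<^sup>*\<^sup>* t w" "eqAC Th v w" by blast
  have "s = v" "t = w"
    using 1(1,2) assms(2,3) unfolding normal_def by (auto elim: converse_rtranclpE)
  with 1 show ?thesis by simp
qed

lemma eqAC_eqE: "eqAC Th s t \<Longrightarrow> eqE Th s t"
proof -
  have sub: "all_ac_axioms Th \<subseteq> axsE Th"
    using disjoint unfolding disjoint_combination_def all_ac_axioms_def axsE_def by blast
  have "rw (axsE Th) x y" if "rw (all_ac_axioms Th) x y" for x y
    using that by (induction rule: rw.induct) (use sub in \<open>auto intro: rw.intros\<close>)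
  then have step: "step Th (axsE Th) x y" if "step Th (all_ac_axioms Th) x y" for x y
    using that by (simp add: step_def)
  show "eqE Th s t" if "eqAC Th s t"
    using that unfolding eqAC_def eqE_def
    by (induction rule: equivclp_induct) (auto dest: step intro: equivclp_into_equivclp)
qed

lemma Var_eqE: "eqE Th (Var x) (Var y) \<Longrightarrow> x = y"
  using normal_eqE_eqAC[OF _ normal_Var normal_Var] eqAC_mvars by fastforce

text \<open>The axioms act above the aliens only, so a uniform replacement of aliens maps a proof in
  the component theory to another such proof.\<close>

lemma lequiv_hat:
  assumes "lequiv Th i s t" "i \<in> ix" "\<And>u. is_term Th u \<Longrightarrow> is_term Th (\<rho> u)"
  shows "lequiv Th i (hat Th \<rho> i s) (hat Th \<rho> i t)"
  using assms(1)
proof (induction rule: lequiv.induct)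
  case (ax l r \<sigma>)
  have "is_term Th (hat Th \<rho> i (subst \<sigma> l))" "is_term Th (hat Th \<rho> i (subst \<sigma> r))"
    using ax by (auto intro!: is_term_hat assms(3) intro: is_term_aliens)
  with ax(1) axs_terms_over[OF ax(1) assms(2)] show ?case
    by (simp add: hat_subst lequiv.ax)
qed (auto intro: lequiv.intros)

lemma lequiv_Var: "i \<in> ix \<Longrightarrow> lequiv Th i (Var x) (Var y) \<Longrightarrow> x = y"
  using lequiv_eqE Var_eqE by fastforce

text \<open>If \<open>a\<close> did not occur among the aliens of \<open>s\<close>, it could be
  replaced by any variable without changing \<open>s\<close>. All variables would then be equal,
  against consistency.\<close>

lemma lequiv_alien_mem:
  assumes "lequiv Th i s a" "alien Th i a" "i \<in> ix"
  shows "a \<in> aliens Th i s"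
proof (rule ccontr)
  assume a: "a \<notin> aliens Th i s"
  have "lequiv Th i s (Var x)" for x
  proof -
    have "lequiv Th i (hat Th (id(a := Var x)) i s) (hat Th (id(a := Var x)) i a)"
      using assms by (intro lequiv_hat) auto
    moreover have "hat Th (id(a := Var x)) i s = s"
      using a by (intro hat_id) auto
    ultimately show ?thesis by (simp add: hat_alien assms(2))
  qed
  then have "lequiv Th i (Var 0) (Var 1)" by (metis lequiv.sym lequiv.trans)
  from lequiv_Var[OF assms(3) this] show False by simp
qed

lemma lequiv_alien_unique:
  "\<lbrakk>lequiv Th i a b; alien Th i a; alien Th i b; i \<in> ix\<rbrakk> \<Longrightarrow> a = b"
  using lequiv_alien_mem[of i a b] by (simp add: aliens_alien)

section \<open>Canonical representatives\<close>

text \<open>\<open>Var 0\<close> serves as a default alien: the class of a term such as \<open>f(x)\<close> under \<open>f(x) = f(y)\<close>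
  has no member whose aliens occur in all other members.\<close>

definition is_crep :: "nat \<Rightarrow> ('f, 'n) msg \<Rightarrow> ('f, 'n) msg \<Rightarrow> bool" where
  "is_crep i s t \<longleftrightarrow> lequiv Th i s t \<and>
     (\<forall>u. lequiv Th i s u \<longrightarrow> aliens Th i t \<subseteq> insert (Var 0) (aliens Th i u)) \<and>
     (\<forall>a. alien Th i a \<and> lequiv Th i s a \<longrightarrow> t = a)"

definition crep :: "nat \<Rightarrow> ('f, 'n) msg \<Rightarrow> ('f, 'n) msg" where
  "crep i s = (SOME t. is_crep i s t)"

text \<open>If the class contains an alien term, this term is unique and occurs among the aliens of
  every member. Otherwise a member with the fewest aliens is taken: an alien of it that is missing
  from another member could be replaced by \<open>Var 0\<close>, giving a member with fewer.\<close>

lemma is_crep_exists: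
  assumes "i \<in> ix"
  shows "\<exists>t. is_crep i s t"
proof (cases "\<exists>a. alien Th i a \<and> lequiv Th i s a")
  case True
  then obtain a where a: "alien Th i a" "lequiv Th i s a" by blast
  have "is_crep i s a"
    unfolding is_crep_def
  proof (intro conjI allI impI)
    fix u assume "lequiv Th i s u"
    then have "lequiv Th i u a" using a(2) by (metis lequiv.sym lequiv.trans)
    then show "aliens Th i a \<subseteq> insert (Var 0) (aliens Th i u)"
      using a(1) assms lequiv_alien_mem by (auto simp: aliens_alien)
  next
    fix b assume "alien Th i b \<and> lequiv Th i s b"
    with a assms show "a = b" by (metis lequiv.sym lequiv.trans lequiv_alien_unique)
  qed (rule a(2))
  then show ?thesis ..
next
  case False
  \<comment> \<open>\<open>Var 0\<close> is not counted, as the replacement may introduce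
    it.\<close>
  define c where "c = (\<lambda>t. card (aliens Th i t - {Var 0}))"
  obtain t where t: "lequiv Th i s t" "\<And>u. lequiv Th i s u \<Longrightarrow> c t \<le> c u"
    using ex_has_least_nat[of "lequiv Th i s" s c] lequiv.refl by blast
  have "aliens Th i t \<subseteq> insert (Var 0) (aliens Th i u)" if u: "lequiv Th i s u" for u
  proof (rule ccontr)
    assume "\<not> ?thesis"
    then obtain a where a: "a \<in> aliens Th i t" "a \<noteq> Var 0" "a \<notin> aliens Th i u" by blast
    define \<rho> where "\<rho> = id(a := Var 0 :: ('f, 'n) msg)"
    have "lequiv Th i t u" using t(1) u by (metis lequiv.sym lequiv.trans)
    then have "lequiv Th i (hat Th \<rho> i t) (hat Th \<rho> i u)"
      using assms by (intro lequiv_hat) (auto simp: \<rho>_def)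
    moreover have "hat Th \<rho> i u = u" using a(3) by (intro hat_id) (auto simp: \<rho>_def)
    ultimately have "lequiv Th i s (hat Th \<rho> i t)"
      using u by (metis lequiv.sym lequiv.trans)
    from t(2)[OF this] have "c t \<le> c (hat Th \<rho> i t)" .
    moreover have "aliens Th i (hat Th \<rho> i t) - {Var 0} \<subset> aliens Th i t - {Var 0}"
    proof -
      have "aliens Th i (\<rho> b) = {\<rho> b}" if "b \<in> aliens Th i t" for b
        using alien_aliens[OF that] by (auto simp: \<rho>_def aliens_alien)
      then have "aliens Th i (hat Th \<rho> i t) = \<rho> ` aliens Th i t" by (auto simp: aliens_hat)
      with a(1,2) show ?thesis by (auto simp: \<rho>_def)
    qed
    then have "c (hat Th \<rho> i t) < c t"
      unfolding c_def by (intro psubset_card_mono) (auto simp: finite_aliens)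
    ultimately show False by simp
  qed
  with t(1) False have "is_crep i s t" unfolding is_crep_def by blast
  then show ?thesis ..
qed

lemma is_crep_crep: "i \<in> ix \<Longrightarrow> is_crep i s (crep i s)"
  unfolding crep_def using is_crep_exists by (rule someI_ex)

lemma lequiv_crep: "i \<in> ix \<Longrightarrow> lequiv Th i s (crep i s)"
  using is_crep_crep is_crep_def by blast

lemma aliens_crep: "i \<in> ix \<Longrightarrow> aliens Th i (crep i s) \<subseteq> insert (Var 0) (aliens Th i s)"
  using is_crep_crep[of i s] lequiv.refl unfolding is_crep_def by blast

lemma crep_alien: "\<lbrakk>i \<in> ix; alien Th i a\<rbrakk> \<Longrightarrow> crep i a = a"
  using is_crep_crep[of i a] lequiv.refl unfolding is_crep_def by blast

lemma crep_eqI: "lequiv Th i s t \<Longrightarrow> crep i s = crep i t"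
proof -
  assume "lequiv Th i s t"
  \<comment> \<open>Equal classes make the two choice predicates identical, hence also the chosen
    terms.\<close>
  then have "lequiv Th i s = lequiv Th i t"
    by (intro ext) (metis lequiv.sym lequiv.trans)
  then show "crep i s = crep i t" unfolding crep_def is_crep_def by simp
qed

lemma crep_crep: "i \<in> ix \<Longrightarrow> crep i (crep i s) = crep i s"
  using crep_eqI lequiv_crep by metis

section \<open>The layerwise normal form\<close>

definition index_of :: "'f \<Rightarrow> nat" where
  "index_of f = (SOME i. i \<in> ix \<and> f \<in> sig_of Th i)"

lemma index_of_eq: "\<lbrakk>i \<in> ix; f \<in> sig_of Th i\<rbrakk> \<Longrightarrow> index_of f = i"
  unfolding index_of_def by (metis (mono_tags, lifting) sig_of_unique someI)

fun nu :: "('f, 'n) msg \<Rightarrow> ('f, 'n) msg" where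
  "nu (Var x) = Var x"
| "nu (Name a) = Name a"
| "nu (Pub M) = Pub (nu M)"
| "nu (Sign M K) = Sign (nu M) (nu K)"
| "nu (Blind M K) = Blind (nu M) (nu K)"
| "nu (MPair M K) = MPair (nu M) (nu K)"
| "nu (Enc M K) = Enc (nu M) (nu K)"
| "nu (Fn f ts) = (if f \<in> sigE Th then crep (index_of f) (Fn f (map nu ts)) else Fn f (map nu ts))"

text \<open>Every layer reached from the root without crossing a term alien to all theories is its
  own representative. Below such a term nothing is required, since \<open>crep\<close> and
  \<open>aliens\<close> never look there.\<close>

inductive canonical :: "('f, 'n) msg \<Rightarrow> bool" where
  atom: "(\<And>i. i \<in> ix \<Longrightarrow> alien Th i t) \<Longrightarrow> canonical t"
| layer: "i \<in> ix \<Longrightarrow> \<not> alien Th i t \<Longrightarrow> crep i t = t \<Longrightarrow> (\<And>a. a \<in> aliens Th i t \<Longrightarrow> canonical a)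
    \<Longrightarrow> canonical t"

lemma not_alien_unique: "\<lbrakk>\<not> alien Th i t; \<not> alien Th j t; i \<in> ix; j \<in> ix\<rbrakk> \<Longrightarrow> i = j"
  unfolding alien_def using sig_of_unique by blast

text \<open>By disjointness at most one theory sees a layer at the root; for every other theory the
  term is a single alien, which \<open>crep\<close> fixes.\<close>

lemma canonicalD:
  assumes "canonical t" "i \<in> ix"
  shows "crep i t = t" "a \<in> aliens Th i t \<Longrightarrow> canonical a"
proof -
  have "crep i t = t \<and> (\<forall>a\<in>aliens Th i t. canonical a)"
  proof (cases "alien Th i t")
    case True
    then show ?thesis using assms by (simp add: crep_alien aliens_alien)
  next
    case False
    from assms(1) show ?thesis
    proof (cases rule: canonical.cases)
      case (layer j)
      with False assms(2) not_alien_unique have "j = i" by blast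
      with layer show ?thesis by simp
    qed (use False assms in auto)
  qed
  then show "crep i t = t" "a \<in> aliens Th i t \<Longrightarrow> canonical a" by auto
qed

lemma canonical_nu: "canonical (nu t)"
proof (induction t)
  case (Fn f ts)
  show ?case
  proof (cases "f \<in> sigE Th")
    case True
    then obtain i where i: "i \<in> ix" "f \<in> sig_of Th i" by (auto simp: sigE_def)
    define s where "s = Fn f (map nu ts)"
    have nu: "nu (Fn f ts) = crep i s" using True by (simp add: index_of_eq[OF i] s_def)
    have "canonical a" if "a \<in> aliens Th i s" for a
    proof -
      from that i(2) obtain t where "t \<in> set ts" "a \<in> aliens Th i (nu t)"
        by (auto simp: s_def)
      then show ?thesis using canonicalD(2)[OF Fn.IH i(1)] by blast
    qed
    then have al: "canonical a" if "a \<in> aliens Th i (crep i s)" for a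
      using that aliens_crep[OF i(1), of s] canonical.atom[of "Var 0"] by auto
    \<comment> \<open>The representative may have collapsed to an alien, possibly the default
      \<open>Var 0\<close>; its canonicity is then already known. Otherwise it forms a new
      layer.\<close>
    show ?thesis
    proof (cases "alien Th i (crep i s)")
      case True
      then show ?thesis using al unfolding nu by (simp add: aliens_alien)
    next
      case False
      then show ?thesis
        unfolding nu by (rule canonical.layer[OF i(1) _ crep_crep[OF i(1)]]) (rule al)
    qed
  qed (auto intro!: canonical.atom simp: sigE_def)
qed (auto intro: canonical.atom)

lemma crep_nu: "i \<in> ix \<Longrightarrow> crep i (nu t) = nu t"
  by (rule canonicalD(1)[OF canonical_nu])

lemma nu_Fn: "\<lbrakk>i \<in> ix; f \<in> sig_of Th i\<rbrakk> \<Longrightarrow> nu (Fn f ts) = crep i (Fn f (map nu ts))"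
  using sig_of_sigE[of i] index_of_eq[of i f] by auto

lemma crep_Fn:
  assumes "i \<in> ix" "f \<in> sig_of Th i"
  shows "crep i (Fn f (map (\<lambda>t. crep i (g t)) ts)) = crep i (Fn f (map g ts))"
proof (intro crep_eqI lequiv_Fn assms(2))
  show "list_all2 (lequiv Th i) (map (\<lambda>t. crep i (g t)) ts) (map g ts)"
    unfolding list.rel_map
    by (rule list.rel_refl_strong) (rule lequiv.sym[OF lequiv_crep[OF assms(1)]])
qed

text \<open>Above the instantiated variables, the representatives chosen at inner symbols are
  absorbed by the outermost choice.\<close>

lemma nu_subst:
  assumes "l \<in> terms_over Th (sig_of Th i)" "i \<in> ix"
  shows "nu (subst \<sigma> l) = crep i (subst (\<lambda>x. nu (\<sigma> x)) l)"
  using assms(1)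
proof (induction rule: terms_over.induct)
  case (1 x)
  then show ?case using assms(2) by (simp add: crep_nu)
next
  case (2 f ts)
  have "nu (subst \<sigma> (Fn f ts)) = crep i (Fn f (map (\<lambda>t. nu (subst \<sigma> t)) ts))"
    using 2 assms(2) by (simp add: nu_Fn comp_def del: nu.simps)
  also have "map (\<lambda>t. nu (subst \<sigma> t)) ts = map (\<lambda>t. crep i (subst (\<lambda>x. nu (\<sigma> x)) t)) ts"
    using 2 by auto
  also have "crep i (Fn f \<dots>) = crep i (subst (\<lambda>x. nu (\<sigma> x)) (Fn f ts))"
    using crep_Fn[OF assms(2) 2(1)] by simp
  finally show ?case .
qed

lemma is_term_crep: "i \<in> ix \<Longrightarrow> is_term Th (crep i t) \<longleftrightarrow> is_term Th t"
  using lequiv_crep lequiv_is_term by metis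

lemma is_term_nu: "is_term Th t \<Longrightarrow> is_term Th (nu t)"
proof (induction t)
  case (Fn f ts)
  then obtain i where i: "i \<in> ix" "f \<in> sig_of Th i" by (auto simp: sigE_def)
  with Fn show ?case by (simp add: nu_Fn is_term_crep del: nu.simps)
qed auto

text \<open>At the root, \<open>nu_subst\<close> turns both sides into representatives of an
  instance of the same axiom. Elsewhere \<open>nu\<close> is computed from its values on the
  arguments.\<close>

lemma nu_rw: "rw (axsE Th) s t \<Longrightarrow> is_term Th s \<Longrightarrow> is_term Th t \<Longrightarrow> nu s = nu t"
proof (induction rule: rw.induct)
  case (root l r \<sigma>)
  from root(1) obtain i where i: "i \<in> ix" "(l, r) \<in> axs Th i" by (auto simp: axsE_def)
  note over = axs_terms_over[OF i(2,1)]
  \<comment> \<open>The images under \<open>\<sigma>\<close> are known to be well formed only for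
    variables occurring in the rule, hence an induction on \<open>u\<close>.\<close>
  have *: "is_term Th (subst (\<lambda>x. nu (\<sigma> x)) u)"
    if "u \<in> terms_over Th (sig_of Th i)" "is_term Th (subst \<sigma> u)" for u
    using that by (induction rule: terms_over.induct) (auto intro: is_term_nu)
  have "lequiv Th i (subst (\<lambda>x. nu (\<sigma> x)) l) (subst (\<lambda>x. nu (\<sigma> x)) r)"
    using root over i by (intro lequiv.ax) (auto intro: *)
  then show ?case using over i(1) by (auto simp: nu_subst intro: crep_eqI)
qed auto

lemma eqE_nu_eq: "eqE Th s t \<Longrightarrow> nu s = nu t"
  unfolding eqE_def
  by (induction rule: equivclp_induct) (auto simp: step_def dest: nu_rw)

lemma eqE_nu: "is_term Th t \<Longrightarrow> eqE Th t (nu t)"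
proof (induction t)
  case (Fn f ts)
  then obtain i where i: "i \<in> ix" "f \<in> sig_of Th i" by (auto simp: sigE_def)
  have "eqE Th (Fn f ts) (Fn f (map nu ts))"
    using Fn unfolding eqE_def
    by (intro conv_Fn) (auto simp: list.rel_map intro!: list.rel_refl_strong)
  moreover have "eqE Th (Fn f (map nu ts)) (nu (Fn f ts))"
    unfolding nu_Fn[OF i] using Fn.prems i
    by (intro lequiv_eqE[of Th i] lequiv_crep) (auto intro: is_term_nu)
  ultimately show ?case unfolding eqE_def by (rule equivclp_trans)
qed (auto simp: eqE_def intro: conv_Pub conv_Sign conv_Blind conv_MPair conv_Enc)

lemma eqE_hat_nu: "is_term Th t \<Longrightarrow> eqE Th t (hat Th nu i t)"
proof -
  assume "is_term Th t"
  then have "eqE Th (hat Th id i t) (hat Th nu i t)"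
    unfolding eqE_def using eqE_nu unfolding eqE_def
    by (intro conv_hat) (auto dest: is_term_aliens)
  moreover have "hat Th id i t = t" by (rule hat_id) simp
  ultimately show "eqE Th t (hat Th nu i t)" by simp
qed

text \<open>The bottom-up computation of \<open>nu\<close> is seen here from theory
  \<open>i\<close>: normalise the aliens first, then choose one representative for the whole top
  layer.\<close>

lemma crep_hat_nu: "i \<in> ix \<Longrightarrow> crep i (hat Th nu i t) = nu t"
proof (induction t)
  case (Fn f ts)
  show ?case
  proof (cases "f \<in> sig_of Th i")
    case True
    have "nu (Fn f ts) = crep i (Fn f (map nu ts))" using True Fn.prems by (rule nu_Fn[rotated])
    also have "map nu ts = map (\<lambda>t. crep i (hat Th nu i t)) ts" using Fn by auto
    also have "crep i (Fn f \<dots>) = crep i (hat Th nu i (Fn f ts))"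
      using crep_Fn[OF Fn.prems True] True by simp
    finally show ?thesis by simp
  next
    case False
    then show ?thesis using crep_nu[OF Fn.prems, of "Fn f ts"] by simp
  qed
qed (auto simp: crep_alien)

text \<open>The modularity principle for which \<open>nu\<close> is built: once the aliens are
  normalised, equality in the combination is equality in a single component with aliens as
  atoms.\<close>

lemma eqE_lequiv:
  assumes "eqE Th s t" "i \<in> ix"
  shows "lequiv Th i (hat Th nu i s) (hat Th nu i t)"
proof -
  have "crep i (hat Th nu i s) = crep i (hat Th nu i t)"
    using assms by (simp add: crep_hat_nu eqE_nu_eq)
  then show ?thesis using lequiv_crep[OF assms(2)] by (metis lequiv.sym lequiv.trans)
qed

section \<open>Normal terms and their layers\<close>

abbreviation nf :: "('f, 'n) msg \<Rightarrow> bool" where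
  "nf t \<equiv> is_term Th t \<and> normal Th R t"

lemma nf_subterms: "nf t \<Longrightarrow> u \<in> subterms t \<Longrightarrow> nf u"
  using normal_subterms is_term_subterms by blast

lemma nf_aliens: "nf t \<Longrightarrow> a \<in> aliens Th i t \<Longrightarrow> nf a"
  using nf_subterms aliens_subterms by blast

lemma nu_eq_iff: "nf s \<Longrightarrow> nf t \<Longrightarrow> nu s = nu t \<longleftrightarrow> eqAC Th s t"
proof
  assume "nf s" "nf t" "nu s = nu t"
  then have "eqE Th s t"
    using eqE_nu[of s] eqE_nu[of t] unfolding eqE_def by (metis equivclp_sym equivclp_trans)
  with \<open>nf s\<close> \<open>nf t\<close> show "eqAC Th s t" by (blast intro: normal_eqE_eqAC)
qed (simp add: eqAC_eqE eqE_nu_eq)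

text \<open>A normal term does not collapse to one of its aliens, since these are normal and smaller.\<close>

lemma alien_nu: "nf t \<Longrightarrow> i \<in> ix \<Longrightarrow> alien Th i t \<Longrightarrow> alien Th i (nu t)"
proof (induction t arbitrary: i rule: measure_induct_rule[of size])
  case (less t)
  show ?case
  proof (cases t)
    case (Fn f ts)
    with less.prems obtain j where j: "j \<in> ix" "f \<in> sig_of Th j" by (auto simp: sigE_def)
    have t: "\<not> alien Th j t" using j by (simp add: Fn)
    \<comment> \<open>It is enough that \<open>nu t\<close> keeps a head in the theory
      \<open>j\<close> of \<open>t\<close>; by disjointness it is then alien to
      \<open>i\<close>.\<close>
    have "\<not> alien Th j (nu t)"
    proof
      assume a: "alien Th j (nu t)"
      have "lequiv Th j (hat Th nu j t) (nu t)"
        using lequiv_crep[OF j(1), of "hat Th nu j t"] by (simp only: crep_hat_nu[OF j(1)])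
      from lequiv_alien_mem[OF this a j(1)] obtain b where
        b: "b \<in> aliens Th j t" "nu t \<in> aliens Th j (nu b)" by (auto simp: aliens_hat)
      note alien = alien_aliens[OF b(1)]
      with t have "b \<noteq> t" by blast
      with b(1) have size: "size b < size t" using aliens_factor factor_size by blast
      have nf: "nf b" using less.prems(1) b(1) nf_aliens by blast
      from less.IH[OF size nf j(1) alien] b(2) have "nu t = nu b" by (simp add: aliens_alien)
      with less.prems(1) nf have "eqAC Th t b" by (simp add: nu_eq_iff)
      with size show False using eqAC_size by fastforce
    qed
    with j(1) less.prems(2,3) t show ?thesis using not_alien_unique by blast
  qed auto
qed

text \<open>Normality keeps each \<open>nu b\<close> alien, so it cannot merge into the layer above
  it.\<close>

lemma aliens_hat_nu:
  assumes "\<And>b. b \<in> aliens Th i D \<Longrightarrow> nf b" "i \<in> ix"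
  shows "aliens Th i (hat Th nu i D) = nu ` aliens Th i D"
proof -
  have "aliens Th i (nu b) = {nu b}" if "b \<in> aliens Th i D" for b
    using that assms by (intro aliens_alien alien_nu) (auto intro: alien_aliens)
  then show ?thesis by (auto simp: aliens_hat)
qed

lemma nf_layer_aliens:
  "D \<in> layer Th i S \<Longrightarrow> (\<And>s. s \<in> S \<Longrightarrow> nf s) \<Longrightarrow> b \<in> aliens Th i D \<Longrightarrow> nf b"
  using layer_aliens nf_aliens by blast

text \<open>After normalising aliens, \<open>nu M\<close> is an atom equal to a layer term and so
  occurs among its aliens. Equality of \<open>nu\<close> on normal terms is equality modulo
  AC.\<close>

lemma alien_eqE_layer:
  assumes "i \<in> ix" "nf M" "alien Th i M" "D \<in> layer Th i S" "\<And>s. s \<in> S \<Longrightarrow> nf s" "eqE Th M D"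
  shows "\<exists>s\<in>S. \<exists>b\<in>aliens Th i s. eqAC Th M b"
proof -
  have "lequiv Th i (hat Th nu i D) (nu M)"
    using lequiv.sym[OF eqE_lequiv[OF assms(6,1)]] assms(3) by (simp add: hat_alien)
  from lequiv_alien_mem[OF this alien_nu[OF assms(2,1,3)] assms(1)]
  obtain b where b: "b \<in> aliens Th i D" "nu M = nu b"
    using aliens_hat_nu[OF nf_layer_aliens[OF assms(4,5)] assms(1)] by auto
  moreover have "nf b" using nf_layer_aliens assms(4,5) b(1) by blast
  ultimately show ?thesis
    using layer_aliens[OF assms(4)] assms(2) by (auto simp: nu_eq_iff)
qed

text \<open>In the equation between \<open>T\<close> and \<open>D\<close> the atom
  \<open>nu M\<close> is replaced by \<open>M'\<close>. The side of \<open>T\<close> does not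
  contain this atom, and in \<open>D\<close> only the copies of \<open>M\<close> itself are
  affected, not the members of \<open>\<Gamma>\<close>.\<close>

lemma replace_alien:
  assumes j: "j \<in> ix" and M: "nf M" "alien Th j M" and T: "nf T" and \<Gamma>: "\<And>s. s \<in> \<Gamma> \<Longrightarrow> nf s"
    and D: "D \<in> layer Th j (insert M \<Gamma>)" "eqE Th T D"
    and notT: "\<And>b. b \<in> aliens Th j T \<Longrightarrow> \<not> eqAC Th M b"
    and not\<Gamma>: "\<And>s b. s \<in> \<Gamma> \<Longrightarrow> b \<in> aliens Th j s \<Longrightarrow> \<not> eqAC Th M b"
    and M': "is_term Th M'"
  shows "\<exists>D'\<in>layer Th j (insert M' \<Gamma>). eqE Th T D'"
proof
  \<comment> \<open>\<open>\<rho>\<close> edits the normalised aliens, \<open>\<rho>'\<close> the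
    actual ones. They agree modulo \<open>E\<close> on \<open>D\<close>, because \<open>M\<close> is
    the only alien of \<open>D\<close> whose \<open>nu\<close> is \<open>nu M\<close>.\<close>
  define \<rho> where "\<rho> = id(nu M := M')"
  define \<rho>' where "\<rho>' = id(M := M')"
  have nfD: "nf b" if "b \<in> aliens Th j D" for b
    using nf_layer_aliens[OF D(1) _ that] M \<Gamma> by blast
  have "is_term Th D"
    using D(1) sig_of_sigE[OF j] by (rule layer_is_term) (use M \<Gamma> in auto)
  have "lequiv Th j (hat Th \<rho> j (hat Th nu j T)) (hat Th \<rho> j (hat Th nu j D))"
    using eqE_lequiv[OF D(2) j] j by (rule lequiv_hat) (auto simp: \<rho>_def M')
  moreover have "hat Th \<rho> j (hat Th nu j T) = hat Th nu j T"
  proof (rule hat_id)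
    fix a assume "a \<in> aliens Th j (hat Th nu j T)"
    then obtain b where "b \<in> aliens Th j T" "a = nu b"
      using aliens_hat_nu[OF nf_aliens[OF T] j] by auto
    with notT[of b] M(1) nf_aliens[OF T] show "\<rho> a = a"
      by (auto simp: \<rho>_def nu_eq_iff dest: eqAC_sym)
  qed
  ultimately have "eqE Th (hat Th nu j T) (hat Th \<rho> j (hat Th nu j D))"
    using T j by (auto intro!: lequiv_eqE is_term_hat is_term_nu intro: is_term_aliens)
  then have 1: "eqE Th T (hat Th \<rho> j (hat Th nu j D))"
    using eqE_hat_nu[of T j] T unfolding eqE_def by (blast intro: equivclp_trans)
  have "is_term Th (\<rho>' b) \<and> eqE Th (\<rho>' b) (hat Th \<rho> j (nu b))" if b: "b \<in> aliens Th j D" for b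
  proof -
    have alien: "alien Th j (nu b)" using alien_nu[OF nfD[OF b] j] b alien_aliens by blast
    show ?thesis
    proof (cases "b = M")
      case True
      then show ?thesis using M' alien by (simp add: hat_alien \<rho>_def \<rho>'_def eqE_def)
    next
      case False
      with b layer_aliens[OF D(1) b] not\<Gamma> M have "\<not> eqAC Th M b"
        by (auto simp: aliens_alien)
      with False show ?thesis
        using nfD[OF b] M alien
        by (auto simp: hat_alien \<rho>_def \<rho>'_def nu_eq_iff intro: eqE_nu dest: eqAC_sym)
    qed
  qed
  then have "eqE Th (hat Th \<rho>' j D) (hat Th \<rho> j (hat Th nu j D))"
    unfolding hat_hat eqE_def using \<open>is_term Th D\<close> by (intro conv_hat) auto
  with 1 show "eqE Th T (hat Th \<rho>' j D)"
    unfolding eqE_def by (blast intro: equivclp_trans equivclp_sym)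
  show "hat Th \<rho>' j D \<in> layer Th j (insert M' \<Gamma>)"
    using D(1)
  proof (rule layer_hat)
    fix s assume s: "s \<in> insert M \<Gamma>"
    show "hat Th \<rho>' j s \<in> layer Th j (insert M' \<Gamma>)"
    proof (cases "s = M")
      case True
      then show ?thesis using M by (auto simp: hat_alien \<rho>'_def intro: layer.base)
    next
      case False
      with s have "s \<in> \<Gamma>" by blast
      then have "hat Th \<rho>' j s = s"
        using not\<Gamma>[of s M] by (intro hat_id) (auto simp: \<rho>'_def)
      with \<open>s \<in> \<Gamma>\<close> show ?thesis by (auto intro: layer.base)
    qed
  qed
qed

text \<open>If \<open>T\<close> had an alien, then two copies of \<open>T\<close> with this alien replaced by distinct variables
  would be equal normal forms.\<close>

lemma no_aliens:
  assumes j: "j \<in> ix" and M: "nf M" "alien Th j M" and T: "nf T" "ground T"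
    and D: "D \<in> layer Th j {M}" "eqE Th T D"
    and notT: "\<And>b. b \<in> aliens Th j T \<Longrightarrow> \<not> eqAC Th M b"
  shows "aliens Th j T = {}"
proof (rule ccontr)
  assume "aliens Th j T \<noteq> {}"
  then obtain b where b: "b \<in> aliens Th j T" by blast
  define \<rho> where "\<rho> = (\<lambda>x. id(nu b := Var x :: ('f, 'n) msg))"
  \<comment> \<open>All aliens with the same \<open>nu\<close> as \<open>b\<close> get the same
    variable, since \<open>hat Th nu j T\<close> no longer tells them apart.\<close>
  define T' where "T' = (\<lambda>x. hat Th (\<lambda>c. if nu c = nu b then Var x else c) j T)"
  have nb: "nf b" using nf_aliens[OF T(1) b] .
  have nfc: "nf c" if "c \<in> aliens Th j T" for c using nf_aliens[OF T(1) that] .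
  have ne: "nu b \<noteq> nu M" using notT[OF b] nb M by (auto simp: nu_eq_iff dest: eqAC_sym)
  have isT': "is_term Th (T' x)" for x
    unfolding T'_def using T nfc by (auto intro!: is_term_hat)
  have eqT': "eqE Th (T' x) (hat Th nu j D)" for x
  proof -
    have "lequiv Th j (hat Th (\<rho> x) j (hat Th nu j T)) (hat Th (\<rho> x) j (hat Th nu j D))"
      using eqE_lequiv[OF D(2) j] j by (rule lequiv_hat) (auto simp: \<rho>_def)
    \<comment> \<open>Every alien on this side is \<open>nu M\<close>, which differs from
      \<open>nu b\<close>. The side is thus independent of \<open>x\<close>, and all the terms
      \<open>T' x\<close> are equal to it.\<close>
    moreover have "hat Th (\<rho> x) j (hat Th nu j D) = hat Th nu j D"
    proof (rule hat_id)
      fix a assume "a \<in> aliens Th j (hat Th nu j D)"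
      then have "a = nu M"
        using layer_aliens[OF D(1)] M alien_nu[OF M(1) j M(2)]
        by (auto simp: aliens_hat aliens_alien)
      with ne show "\<rho> x a = a" by (simp add: \<rho>_def)
    qed
    moreover have "hat Th (\<rho> x) j (hat Th nu j T) =
        hat Th (\<lambda>c. if nu c = nu b then Var x else nu c) j T"
      unfolding hat_hat
    proof (rule hat_cong)
      fix c assume c: "c \<in> aliens Th j T"
      have "alien Th j (nu c)" using alien_nu[OF nfc[OF c] j] alien_aliens[OF c] by blast
      then show "hat Th (\<rho> x) j (nu c) = (if nu c = nu b then Var x else nu c)"
        by (auto simp: hat_alien \<rho>_def)
    qed
    moreover have "is_term Th (hat Th (\<lambda>c. if nu c = nu b then Var x else nu c) j T)"
      using T nfc by (auto intro!: is_term_hat is_term_nu)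
    ultimately have "eqE Th (hat Th (\<lambda>c. if nu c = nu b then Var x else nu c) j T) (hat Th nu j D)"
      using j by (auto intro!: lequiv_eqE)
    moreover have "eqE Th (T' x) (hat Th (\<lambda>c. if nu c = nu b then Var x else nu c) j T)"
      unfolding eqE_def T'_def using T nfc eqE_nu unfolding eqE_def by (intro conv_hat) auto
    ultimately show ?thesis unfolding eqE_def by (blast intro: equivclp_trans)
  qed
  have normalT': "normal Th R (T' x)" for x
  proof -
    have gr: "ground c" if "c \<in> aliens Th j T" for c
      using aliens_subterms[OF that] T(2) by (rule ground_subterms)
    \<comment> \<open>Putting \<open>b\<close> back for the variable yields \<open>T\<close> modulo
      AC, the other aliens being ground. A reduction of \<open>T' x\<close> would therefore give one
      of \<open>T\<close>.\<close>
    have "subst (\<lambda>_. b) (T' x) = hat Th (\<lambda>c. if nu c = nu b then b else c) j T"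
      unfolding T'_def subst_hat using gr by (intro hat_cong) (auto simp: subst_ground)
    moreover have "eqAC Th (hat Th id j T) (hat Th (\<lambda>c. if nu c = nu b then b else c) j T)"
      unfolding eqAC_def using T nfc nb
      by (intro conv_hat) (auto simp: nu_eq_iff eqAC_def[symmetric])
    moreover have "hat Th id j T = T" by (rule hat_id) simp
    ultimately have "eqAC Th T (subst (\<lambda>_. b) (T' x))" by simp
    then have "normal Th R (subst (\<lambda>_. b) (T' x))" using T(1) normal_eqAC by blast
    then show ?thesis
      unfolding normal_def using red_subst[of Th R "T' x" _ "\<lambda>_. b"] nb by blast
  qed
  have "eqE Th (T' 0) (T' 1)"
    using eqT' unfolding eqE_def by (blast intro: equivclp_trans equivclp_sym)
  then have "eqAC Th (T' 0) (T' 1)" using normalT' by (blast intro: normal_eqE_eqAC)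
  then have "mvars (T' 0) = mvars (T' 1)" by (rule eqAC_mvars)
  moreover have "0 \<in> mvars (T' 0)" using b by (auto simp: T'_def mvars_hat)
  moreover have "0 \<notin> mvars (T' 1)"
  proof -
    have "mvars c = {}" if "c \<in> aliens Th j T" for c
      using aliens_subterms[OF that] T(2) ground_subterms ground_iff_mvars by blast
    then show ?thesis by (auto simp: T'_def mvars_hat)
  qed
  ultimately show False by simp
qed

end

section \<open>The sequent system\<close>

lemma derivable_sequent: "derivable Th R c \<Gamma> M \<Longrightarrow> sequent Th R \<Gamma> M"
  by (induction rule: derivable.induct) auto

text \<open>Every derivation has an \<open>id\<close> leaf, which supplies an index. With an index
  available, \<open>id\<close> for a single hole proves every member of the context.\<close>

lemma derivable_num: "derivable Th R c \<Gamma> M \<Longrightarrow> 1 \<le> num Th"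
  by (induction rule: derivable.induct) auto

lemma sequent_mono: "sequent Th R \<Delta> M \<Longrightarrow> \<Gamma> \<subseteq> \<Delta> \<Longrightarrow> sequent Th R \<Gamma> M"
  unfolding sequent_def by blast

lemma acut':
  assumes "i \<in> {1..num Th}" "P \<in> insert M \<Gamma>" "factor Th i N P"
    "derivable Th R c \<Gamma> N" "derivable Th R c (insert N \<Gamma>) M"
  shows "derivable Th R c \<Gamma> M"
  using assms derivable_sequent[OF assms(5)]
  by (intro derivable.acut[of Th R \<Gamma> M i P N c]) (auto intro: sequent_mono)

text \<open>This and the next four lemmas restate the left rules with principal formulas as members
  of the context; that the conclusion is a sequent is inherited from the premise with the larger
  context.\<close>

lemma pL':
  assumes "MPair M N \<in> \<Gamma>" "derivable Th R c (insert M (insert N \<Gamma>)) T"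
  shows "derivable Th R c \<Gamma> T"
  using derivable.pL[of Th R \<Gamma> M N T c] assms derivable_sequent[OF assms(2)]
  by (auto simp: insert_absorb insert_commute intro: sequent_mono)

lemma eL':
  assumes "Enc M K \<in> \<Gamma>" "derivable Th R c \<Gamma> K" "derivable Th R c (insert M (insert K \<Gamma>)) T"
  shows "derivable Th R c \<Gamma> T"
  using derivable.eL[of Th R \<Gamma> M K T c] assms derivable_sequent[OF assms(3)]
  by (auto simp: insert_absorb insert_commute intro: sequent_mono)

lemma signL':
  assumes "Sign M K \<in> \<Gamma>" "Pub L \<in> \<Gamma>" "eqAC Th K L" "derivable Th R c (insert M \<Gamma>) T"
  shows "derivable Th R c \<Gamma> T"
  using derivable.signL[of Th R \<Gamma> M K L T c] assms derivable_sequent[OF assms(4)]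
  by (auto simp: insert_absorb insert_commute intro: sequent_mono)

lemma blindL1':
  assumes "Blind M K \<in> \<Gamma>" "derivable Th R c \<Gamma> K" "derivable Th R c (insert M (insert K \<Gamma>)) T"
  shows "derivable Th R c \<Gamma> T"
  using derivable.blindL1[of Th R \<Gamma> M K T c] assms derivable_sequent[OF assms(3)]
  by (auto simp: insert_absorb insert_commute intro: sequent_mono)

lemma blindL2':
  assumes "Sign (Blind M S) K \<in> \<Gamma>" "derivable Th R c \<Gamma> S"
    "derivable Th R c (insert (Sign M K) (insert S \<Gamma>)) T"
  shows "derivable Th R c \<Gamma> T"
  using derivable.blindL2[of Th R \<Gamma> M S K T c] assms derivable_sequent[OF assms(3)]
  by (auto simp: insert_absorb insert_commute intro: sequent_mono)

section \<open>Weakening modulo AC\<close>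

abbreviation gnf :: "('f, 'n) comb \<Rightarrow> ('f, 'n) eqns \<Rightarrow> ('f, 'n) msg \<Rightarrow> bool" where
  "gnf Th R t \<equiv> is_term Th t \<and> ground t \<and> normal Th R t"

lemma gnf_eqAC: "gnf Th R s \<Longrightarrow> eqAC Th s t \<Longrightarrow> gnf Th R t"
  using normal_eqAC eqAC_mvars conv_is_term unfolding ground_iff_mvars eqAC_def by metis

lemma gnf_args:
  "gnf Th R (Sign A B) \<Longrightarrow> gnf Th R A \<and> gnf Th R B"
  "gnf Th R (Blind A B) \<Longrightarrow> gnf Th R A \<and> gnf Th R B"
  "gnf Th R (MPair A B) \<Longrightarrow> gnf Th R A \<and> gnf Th R B"
  "gnf Th R (Enc A B) \<Longrightarrow> gnf Th R A \<and> gnf Th R B"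
  using normal_subterms[of A _ Th R] normal_subterms[of B _ Th R] subterms_refl[of A] subterms_refl[of B]
  by (metis (no_types, lifting) UnI1 UnI2 ground.simps insertI2 is_term.simps subterms.simps)+

text \<open>Inclusion modulo AC, which lets a single induction on derivations handle both weakening
  and the replacement of hypotheses by AC-equal ones.\<close>

definition covers :: "('f, 'n) comb \<Rightarrow> ('f, 'n) msg set \<Rightarrow> ('f, 'n) msg set \<Rightarrow> bool" where
  "covers Th \<Delta> \<Gamma> \<longleftrightarrow> (\<forall>N\<in>\<Gamma>. \<exists>N'\<in>\<Delta>. eqAC Th N N')"

lemma covers_simps [simp]:
  "covers Th \<Delta> {}"
  "covers Th \<Delta> (insert N \<Gamma>) \<longleftrightarrow> (\<exists>N'\<in>\<Delta>. eqAC Th N N') \<and> covers Th \<Delta> \<Gamma>"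
  "covers Th \<Delta> (\<Gamma> \<union> \<Gamma>') \<longleftrightarrow> covers Th \<Delta> \<Gamma> \<and> covers Th \<Delta> \<Gamma>'"
  by (auto simp: covers_def)

lemma covers_insertI: "covers Th \<Delta> \<Gamma> \<Longrightarrow> covers Th (insert N \<Delta>) \<Gamma>"
  by (auto simp: covers_def)

lemma covers_subset: "\<Gamma> \<subseteq> \<Delta> \<Longrightarrow> covers Th \<Delta> \<Gamma>"
  unfolding covers_def using eqAC_refl by blast

lemma coversD: "covers Th \<Delta> \<Gamma> \<Longrightarrow> N \<in> \<Gamma> \<Longrightarrow> \<exists>N'\<in>\<Delta>. eqAC Th N N'"
  by (simp add: covers_def)

lemma covers_args:
  "covers Th \<Delta> \<Gamma> \<Longrightarrow> Pub M \<in> \<Gamma> \<Longrightarrow> \<exists>A. Pub A \<in> \<Delta> \<and> eqAC Th M A"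
  "covers Th \<Delta> \<Gamma> \<Longrightarrow> Sign M K \<in> \<Gamma> \<Longrightarrow> \<exists>A B. Sign A B \<in> \<Delta> \<and> eqAC Th M A \<and> eqAC Th K B"
  "covers Th \<Delta> \<Gamma> \<Longrightarrow> Blind M K \<in> \<Gamma> \<Longrightarrow> \<exists>A B. Blind A B \<in> \<Delta> \<and> eqAC Th M A \<and> eqAC Th K B"
  "covers Th \<Delta> \<Gamma> \<Longrightarrow> MPair M K \<in> \<Gamma> \<Longrightarrow> \<exists>A B. MPair A B \<in> \<Delta> \<and> eqAC Th M A \<and> eqAC Th K B"
  "covers Th \<Delta> \<Gamma> \<Longrightarrow> Enc M K \<in> \<Gamma> \<Longrightarrow> \<exists>A B. Enc A B \<in> \<Delta> \<and> eqAC Th M A \<and> eqAC Th K B"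
  by (metis coversD eqAC_Pub, metis coversD eqAC_Sign, metis coversD eqAC_Blind,
      metis coversD eqAC_MPair, metis coversD eqAC_Enc)

lemma sequent_eqAC:
  assumes "sequent Th R \<Gamma> M" "eqAC Th M M'" "\<forall>N\<in>\<Delta>. gnf Th R N"
  shows "sequent Th R \<Delta> M'"
proof -
  have "gnf Th R M" using assms(1) by (simp add: sequent_def)
  from gnf_eqAC[OF this assms(2)] assms(3) show ?thesis by (simp add: sequent_def)
qed

context combination
begin

lemma id_layer:
  assumes "sequent Th R \<Gamma> M" "i \<in> ix" "D \<in> layer Th i \<Gamma>" "eqE Th M D"
  shows "derivable Th R c \<Gamma> M"
  using layer_fill[OF assms(3)] assms by (blast intro: derivable.id)

lemma derivable_mem:
  "\<lbrakk>sequent Th R \<Gamma> M; M \<in> \<Gamma>; 1 \<le> num Th\<rbrakk> \<Longrightarrow> derivable Th R c \<Gamma> M"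
  by (rule id_layer[of _ _ 1 M]) (auto intro: layer.base simp: eqE_def)

text \<open>AC-equality is part of \<open>E\<close>, so \<open>id\<close> survives. Constructor
  inversion finds the principal formulas in \<open>\<Delta>\<close>, and \<open>eqAC_factor\<close>
  finds the factor for \<open>acut\<close>. The lemma is needed because \<open>acut\<close> supplies
  a cut formula only up to AC.\<close>

lemma weaken_AC:
  assumes "derivable Th R c \<Gamma> M" "covers Th \<Delta> \<Gamma>" "eqAC Th M M'" "\<forall>N\<in>\<Delta>. gnf Th R N"
  shows "derivable Th R c \<Delta> M'"
  using assms
proof (induction arbitrary: \<Delta> M' rule: derivable.induct)
  case (id \<Gamma> M i C Ms)
  have seq: "sequent Th R \<Delta> M'" using id.hyps(1) id.prems(2,3) by (rule sequent_eqAC)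
  have D: "fill C Ms \<in> layer Th i \<Gamma>" using id.hyps by (blast intro: fill_layer)
  have "is_term Th (fill C Ms)"
    using D sig_of_sigE[OF id.hyps(2)] by (rule layer_is_term)
      (use id.hyps(1) in \<open>auto simp: sequent_def\<close>)
  moreover have "\<exists>u\<in>layer Th i \<Delta>. eqE Th s u" if "s \<in> \<Gamma>" for s
    using coversD[OF id.prems(1) that] eqAC_eqE by (blast intro: layer.base)
  ultimately obtain D' where D': "D' \<in> layer Th i \<Delta>" "eqE Th (fill C Ms) D'"
    using layer_conv[OF D] unfolding eqE_def by blast
  moreover have "eqE Th M' D'"
    using id.hyps(6) eqAC_eqE[OF id.prems(2)] D'(2) unfolding eqE_def
    by (meson equivclp_sym equivclp_trans)
  ultimately show ?case using seq id.hyps(2) by (blast intro: id_layer)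
next
  case (cut \<Gamma> T M)
  have M: "gnf Th R M" using derivable_sequent[OF cut.hyps(3)] by (simp add: sequent_def)
  have seq: "sequent Th R \<Delta> M'" using cut.hyps(2) cut.prems(2,3) by (rule sequent_eqAC)
  have 1: "derivable Th R c \<Delta> M" using cut.prems by (intro cut.IH) auto
  have "derivable Th R c (\<Delta> \<union> {M}) M'"
    using cut.prems M by (intro cut.IH) (auto intro: covers_insertI)
  with cut.hyps(1) seq 1 show ?case by (rule derivable.cut)
next
  case (acut \<Gamma> M i P N)
  obtain P' where P': "P' \<in> insert M' \<Delta>" "eqAC Th P P'"
    using acut.hyps(3) acut.prems(1,2) by (auto dest: coversD)
  then obtain N' where N': "factor Th i N' P'" "eqAC Th N N'"
    using eqAC_factor acut.hyps(4) by blast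
  have "gnf Th R N" using derivable_sequent[OF acut.hyps(5)] by (simp add: sequent_def)
  from gnf_eqAC[OF this N'(2)] have N'_gnf: "gnf Th R N'" .
  have "derivable Th R c (insert N' \<Delta>) M'"
    using acut.prems N' N'_gnf by (intro acut.IH) (auto intro: covers_insertI)
  moreover have "derivable Th R c \<Delta> N'" using acut.prems N' by (intro acut.IH) auto
  ultimately show ?case using acut' acut.hyps(2) P'(1) N'(1) by blast
next
  case (pL \<Gamma> M N T)
  obtain A B where X: "MPair A B \<in> \<Delta>" "eqAC Th M A" "eqAC Th N B"
    using covers_args(4)[OF pL.prems(1), of M N] by auto
  moreover have "gnf Th R (MPair A B)" using X(1) pL.prems(3) by blast
  note gnf_args(3)[OF this]
  ultimately have "derivable Th R c (insert A (insert B \<Delta>)) M'"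
    using pL.prems by (intro pL.IH) (auto intro: covers_insertI)
  with X(1) show ?case by (rule pL')
next
  case (pR \<Gamma> M N)
  obtain A B where X: "M' = MPair A B" "eqAC Th M A" "eqAC Th N B"
    using eqAC_MPair[OF pR.prems(2)] by blast
  have "sequent Th R \<Delta> M'"
    using pR.hyps(1) pR.prems(2,3) by (rule sequent_eqAC)
  with X pR show ?case by (auto intro: derivable.pR)
next
  case (eL \<Gamma> M K N)
  obtain A B where X: "Enc A B \<in> \<Delta>" "eqAC Th M A" "eqAC Th K B"
    using covers_args(5)[OF eL.prems(1), of M K] by auto
  moreover have "gnf Th R (Enc A B)" using X(1) eL.prems(3) by blast
  note gnf_args(4)[OF this]
  ultimately have "derivable Th R c (insert A (insert B \<Delta>)) M'"
    using eL.prems by (intro eL.IH) (auto intro: covers_insertI)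
  moreover have "derivable Th R c \<Delta> B" using eL.prems X by (intro eL.IH)
  ultimately show ?case using X(1) by (blast intro: eL')
next
  case (eR \<Gamma> M K)
  obtain A B where X: "M' = Enc A B" "eqAC Th M A" "eqAC Th K B"
    using eqAC_Enc[OF eR.prems(2)] by blast
  have "sequent Th R \<Delta> M'"
    using eR.hyps(1) eR.prems(2,3) by (rule sequent_eqAC)
  with X eR show ?case by (auto intro: derivable.eR)
next
  case (signL \<Gamma> M K L N)
  obtain A B where X: "Sign A B \<in> \<Delta>" "eqAC Th M A" "eqAC Th K B"
    using covers_args(2)[OF signL.prems(1), of M K] by auto
  obtain L' where Y: "Pub L' \<in> \<Delta>" "eqAC Th L L'"
    using covers_args(1)[OF signL.prems(1), of L] by auto
  have "gnf Th R (Sign A B)" using X(1) signL.prems(3) by blast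
  from gnf_args(1)[OF this] X have "derivable Th R c (insert A \<Delta>) M'"
    using signL.prems by (intro signL.IH) (auto intro: covers_insertI)
  moreover have "eqAC Th B L'" using X Y signL.hyps(2) by (metis eqAC_sym eqAC_trans)
  ultimately show ?case using X Y by (blast intro: signL')
next
  case (signR \<Gamma> M K)
  obtain A B where X: "M' = Sign A B" "eqAC Th M A" "eqAC Th K B"
    using eqAC_Sign[OF signR.prems(2)] by blast
  have "sequent Th R \<Delta> M'"
    using signR.hyps(1) signR.prems(2,3) by (rule sequent_eqAC)
  with X signR show ?case by (auto intro: derivable.signR)
next
  case (blindL1 \<Gamma> M K N)
  obtain A B where X: "Blind A B \<in> \<Delta>" "eqAC Th M A" "eqAC Th K B"
    using covers_args(3)[OF blindL1.prems(1), of M K] by auto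
  moreover have "gnf Th R (Blind A B)" using X(1) blindL1.prems(3) by blast
  note gnf_args(2)[OF this]
  ultimately have "derivable Th R c (insert A (insert B \<Delta>)) M'"
    using blindL1.prems by (intro blindL1.IH) (auto intro: covers_insertI)
  moreover have "derivable Th R c \<Delta> B" using blindL1.prems X by (intro blindL1.IH)
  ultimately show ?case using X(1) by (blast intro: blindL1')
next
  case (blindR \<Gamma> M K)
  obtain A B where X: "M' = Blind A B" "eqAC Th M A" "eqAC Th K B"
    using eqAC_Blind[OF blindR.prems(2)] by blast
  have "sequent Th R \<Delta> M'"
    using blindR.hyps(1) blindR.prems(2,3) by (rule sequent_eqAC)
  with X blindR show ?case by (auto intro: derivable.blindR)
next
  case (blindL2 \<Gamma> M S K N)
  obtain A B where "Sign A B \<in> \<Delta>" "eqAC Th (Blind M S) A" "eqAC Th K B"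
    using covers_args(2)[OF blindL2.prems(1), of "Blind M S" K] by auto
  then obtain A S' where X: "Sign (Blind A S') B \<in> \<Delta>" "eqAC Th M A" "eqAC Th S S'" "eqAC Th K B"
    using eqAC_Blind by blast
  have MK: "gnf Th R (Sign M K)" "gnf Th R S"
    using derivable_sequent[OF blindL2.hyps(3)] by (simp_all add: sequent_def)
  have Sign: "eqAC Th (Sign M K) (Sign A B)"
    using X MK(1) unfolding eqAC_def by (intro conv_Sign) auto
  have "gnf Th R (Sign A B)" "gnf Th R S'"
    using gnf_eqAC[OF MK(1) Sign] gnf_eqAC[OF MK(2) X(3)] by blast+
  with Sign X have "derivable Th R c (insert (Sign A B) (insert S' \<Delta>)) M'"
    using blindL2.prems
    by (intro blindL2.IH) (auto simp del: is_term.simps ground.simps intro: covers_insertI)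
  moreover have "derivable Th R c \<Delta> S'" using blindL2.prems X by (intro blindL2.IH)
  ultimately show ?case using X(1) by (blast intro: blindL2')
qed

lemma weaken:
  "\<lbrakk>derivable Th R c \<Gamma> M; \<Gamma> \<subseteq> \<Delta>; \<forall>N\<in>\<Delta>. gnf Th R N\<rbrakk> \<Longrightarrow> derivable Th R c \<Delta> M"
  by (rule weaken_AC[OF _ covers_subset eqAC_refl])

lemma weaken_insert:
  assumes "derivable Th R c \<Gamma> M" "gnf Th R N"
  shows "derivable Th R c (insert N \<Gamma>) M"
  using assms(1) subset_insertI
  by (rule weaken) (use derivable_sequent[OF assms(1)] assms(2) in \<open>auto simp: sequent_def\<close>)

lemma weaken_context:
  assumes "derivable Th R c (insert M \<Gamma>) T" "derivable Th R c' \<Delta> N" "\<Gamma> \<subseteq> \<Delta>"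
  shows "derivable Th R c (insert M \<Delta>) T"
  using assms(1) insert_mono[OF assms(3)]
  by (rule weaken)
    (use derivable_sequent[OF assms(1)] derivable_sequent[OF assms(2)] in \<open>auto simp: sequent_def\<close>)

section \<open>Admissibility of cut\<close>

text \<open>If \<open>b\<close> is the whole of \<open>P\<close>, it need not be a factor. But then
  it lies in \<open>\<Gamma>\<close>, and the second premise is the claim, or it is
  \<open>T\<close>, and the first premise is.\<close>

lemma acut_alien:
  assumes "i \<in> ix" "P \<in> insert T \<Gamma>" "b \<in> aliens Th i P"
    "derivable Th R c \<Gamma> b" "derivable Th R c (insert b \<Gamma>) T"
  shows "derivable Th R c \<Gamma> T"
  using aliens_factor[OF assms(3)]
proof
  assume "b = P"
  with assms show ?thesis by (auto simp: insert_absorb)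
next
  assume "factor Th i b P"
  with assms show ?thesis by (blast intro: acut')
qed

text \<open>Both premises of the cut on \<open>M\<close> are transferred to its AC variant
  \<open>b\<close>, on which \<open>acut_alien\<close> can act.\<close>

lemma cut_alien:
  assumes "i \<in> ix" "P \<in> insert T \<Gamma>" "b \<in> aliens Th i P" "eqAC Th M b"
    "derivable Th R c \<Gamma> M" "derivable Th R c (insert M \<Gamma>) T"
  shows "derivable Th R c \<Gamma> T"
proof -
  have \<Gamma>: "\<forall>N\<in>insert M \<Gamma>. gnf Th R N"
    using derivable_sequent[OF assms(6)] by (simp add: sequent_def)
  then have "gnf Th R b" using assms(4) gnf_eqAC by blast
  have "derivable Th R c \<Gamma> b"
    using assms(5) covers_subset[OF subset_refl] assms(4) by (rule weaken_AC) (use \<Gamma> in blast)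
  moreover have "derivable Th R c (insert b \<Gamma>) T"
    using assms(6) _ eqAC_refl
  proof (rule weaken_AC)
    show "covers Th (insert b \<Gamma>) (insert M \<Gamma>)"
      using assms(4) covers_subset[of \<Gamma> "insert b \<Gamma>"] by auto
    show "\<forall>N\<in>insert b \<Gamma>. gnf Th R N" using \<Gamma> \<open>gnf Th R b\<close> by blast
  qed
  ultimately show ?thesis using acut_alien[OF assms(1-3)] by blast
qed

text \<open>What a left derivation provides when it ends in a right rule or in \<open>id\<close> for
  the theory of the head symbol. Other terms, in particular \<open>Pub\<close> terms, have no right
  rule and are excluded.\<close>

fun introducible :: "('f, 'n) msg set \<Rightarrow> ('f, 'n) msg \<Rightarrow> bool" where
  "introducible \<Gamma> (Sign A B) = (derivable Th R False \<Gamma> A \<and> derivable Th R False \<Gamma> B)"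
| "introducible \<Gamma> (Blind A B) = (derivable Th R False \<Gamma> A \<and> derivable Th R False \<Gamma> B)"
| "introducible \<Gamma> (MPair A B) = (derivable Th R False \<Gamma> A \<and> derivable Th R False \<Gamma> B)"
| "introducible \<Gamma> (Enc A B) = (derivable Th R False \<Gamma> A \<and> derivable Th R False \<Gamma> B)"
| "introducible \<Gamma> (Fn f ts) =
     (\<exists>i\<in>ix. f \<in> sig_of Th i \<and> (\<exists>D\<in>layer Th i \<Gamma>. eqE Th (Fn f ts) D))"
| "introducible \<Gamma> M = False"

lemma introducible_insert:
  "introducible \<Gamma> M \<Longrightarrow> gnf Th R N \<Longrightarrow> introducible (insert N \<Gamma>) M"
  by (cases M) (auto intro: weaken_insert,
    meson atLeastAtMost_iff One_nat_def layer_mono subset_insertI)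

text \<open>If \<open>M\<close> is not alien to \<open>i\<close>, the context producing
  \<open>M\<close> is plugged into the one producing \<open>T\<close>. If it is alien, either an
  AC-equal alien occurs in \<open>\<Gamma>\<close> or \<open>T\<close> and \<open>acut\<close> takes
  over, or \<open>M\<close> is an irrelevant atom of the equation and can be eliminated.\<close>

lemma cut_id:
  assumes "i \<in> ix" "D \<in> layer Th i (insert M \<Gamma>)" "eqE Th T D"
    and \<Gamma>: "\<forall>N\<in>\<Gamma>. gnf Th R N" and T: "gnf Th R T"
    and M: "introducible \<Gamma> M" "derivable Th R False \<Gamma> M"
  shows "derivable Th R False \<Gamma> T"
proof -
  have gM: "gnf Th R M" using derivable_sequent[OF M(2)] by (simp add: sequent_def)
  have seq: "sequent Th R \<Gamma> T" using \<Gamma> T by (simp add: sequent_def)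
  show ?thesis
  proof (cases "alien Th i M")
    case True
    show ?thesis
    proof (cases "\<exists>P\<in>insert T \<Gamma>. \<exists>b\<in>aliens Th i P. eqAC Th M b")
      case True
      moreover have "derivable Th R False (insert M \<Gamma>) T"
        using assms(1-3) \<Gamma> gM T by (intro id_layer) (auto simp: sequent_def)
      ultimately show ?thesis using cut_alien[OF assms(1)] M(2) by blast
    next
      case False
      have "\<exists>D'\<in>layer Th i \<Gamma>. eqE Th T D'"
      \<comment> \<open>A nonempty context offers a member as replacement for \<open>M\<close>. An
        empty one does not; then \<open>T\<close> has no aliens and is itself a context without
        holes.\<close>
      proof (cases "\<Gamma> = {}")
        case True
        have "aliens Th i T = {}"
          using assms(2,3) gM T \<open>alien Th i M\<close> False True
          by (intro no_aliens[OF assms(1), of M T D]) auto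
        with T have "T \<in> layer Th i \<Gamma>" by (blast intro: layer_pure)
        moreover have "eqE Th T T" by (simp add: eqE_def)
        ultimately show ?thesis by blast
      next
        case False
        then obtain M' where M': "M' \<in> \<Gamma>" by blast
        have "\<exists>D'\<in>layer Th i (insert M' \<Gamma>). eqE Th T D'"
          using assms(1-3) gM T \<Gamma> M' \<open>alien Th i M\<close>
            \<open>\<not> (\<exists>P\<in>insert T \<Gamma>. \<exists>b\<in>aliens Th i P. eqAC Th M b)\<close>
          by (intro replace_alien[of i M T \<Gamma> D]) auto
        with M' show ?thesis by (simp add: insert_absorb)
      qed
      with seq assms(1) show ?thesis by (blast intro: id_layer)
    qed
  next
    case False
    then obtain f ts where f: "M = Fn f ts" "f \<in> sig_of Th i" by (auto simp: alien_def)
    with M(1) obtain j D' where "j \<in> ix" "f \<in> sig_of Th j" "D' \<in> layer Th j \<Gamma>" "eqE Th M D'"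
      by auto
    with f assms(1) have D': "D' \<in> layer Th i \<Gamma>" "eqE Th M D'" using sig_of_unique by blast+
    have "is_term Th D"
      using assms(2) sig_of_sigE[OF assms(1)] by (rule layer_is_term) (use \<Gamma> gM in auto)
    moreover have "\<exists>u\<in>layer Th i \<Gamma>. eqE Th s u" if "s \<in> insert M \<Gamma>" for s
    proof (cases "s = M")
      case False
      with that have "s \<in> layer Th i \<Gamma>" by (blast intro: layer.base)
      moreover have "eqE Th s s" by (simp add: eqE_def)
      ultimately show ?thesis by blast
    qed (use D' in blast)
    ultimately obtain D'' where "D'' \<in> layer Th i \<Gamma>" "eqE Th D D''"
      using layer_conv[OF assms(2)] unfolding eqE_def by blast
    with assms(3) have "eqE Th T D''" unfolding eqE_def by (blast intro: equivclp_trans)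
    with seq assms(1) \<open>D'' \<in> layer Th i \<Gamma>\<close> show ?thesis by (blast intro: id_layer)
  qed
qed

text \<open>Induction on the right derivation. When \<open>M\<close> is principal,
  \<open>introducible\<close> provides its components, and cuts on strictly smaller terms suffice.
  An inclusion is used for \<open>\<Sigma>\<close> so that the claim also covers contexts from which
  \<open>M\<close> is absent; \<open>\<Gamma>\<close> is arbitrary because it grows along the
  derivation.\<close>

lemma cut_introducible:
  assumes smaller: "\<And>N \<Gamma> T. \<lbrakk>size N < size M; derivable Th R False \<Gamma> N;
      derivable Th R False (insert N \<Gamma>) T\<rbrakk> \<Longrightarrow> derivable Th R False \<Gamma> T"
  shows "\<lbrakk>derivable Th R False \<Sigma> T; \<Sigma> \<subseteq> insert M \<Gamma>; \<forall>N\<in>\<Gamma>. gnf Th R N;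
      introducible \<Gamma> M; derivable Th R False \<Gamma> M\<rbrakk> \<Longrightarrow> derivable Th R False \<Gamma> T"
proof (induction arbitrary: \<Gamma> rule: derivable.induct)
  case (id \<Sigma> T i C Ms)
  have "fill C Ms \<in> layer Th i (insert M \<Gamma>)"
    using id.hyps(3-5) id.prems(1) by (blast intro: fill_layer)
  moreover have "gnf Th R T" using id.hyps(1) by (simp add: sequent_def)
  ultimately show ?case using cut_id[OF id.hyps(2) _ id.hyps(6) id.prems(2)] id.prems(3,4) by simp
next
  case (acut \<Sigma> T i P N)
  have N: "gnf Th R N" using derivable_sequent[OF acut.hyps(5)] by (simp add: sequent_def)
  have 1: "derivable Th R False \<Gamma> N" by (rule acut.IH(1)[OF acut.prems])
  have 2: "derivable Th R False (insert N \<Gamma>) T"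
    using acut.prems N
    by (intro acut.IH) (auto intro: introducible_insert weaken_insert)
  show ?case
  proof (cases "P \<in> insert T \<Gamma>")
    case True
    from acut'[OF acut.hyps(2) True acut.hyps(4) 1 2] show ?thesis .
  next
    case False
    \<comment> \<open>The factor came from the eliminated formula, so \<open>acut\<close> is no
      longer applicable. The factor is smaller than \<open>M\<close> and is cut instead.\<close>
    with acut.hyps(3) acut.prems(1) have "P = M" by blast
    with acut.hyps(4) have "size N < size M" using factor_size by blast
    from smaller[OF this 1 2] show ?thesis .
  qed
next
  case (pL \<Sigma> A B T)
  have g: "gnf Th R A" "gnf Th R B" using derivable_sequent[OF pL.hyps(2)] by (auto simp: sequent_def)
  have 1: "derivable Th R False (insert A (insert B \<Gamma>)) T"
    using pL.prems g by (intro pL.IH) (auto intro: introducible_insert weaken_insert)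
  show ?case
  proof (cases "MPair A B \<in> \<Gamma>")
    case True
    from pL'[OF True 1] show ?thesis .
  next
    case False
    with pL.prems(1) have M: "M = MPair A B" by blast
    have "derivable Th R False \<Gamma> A" "derivable Th R False \<Gamma> B"
      using pL.prems(3) by (auto simp: M)
    moreover from this have "derivable Th R False (insert B \<Gamma>) A"
      using pL.prems(2) g by (auto intro: weaken_insert)
    ultimately show ?thesis
      using 1 smaller[of A "insert B \<Gamma>" T] smaller[of B \<Gamma> T] by (simp add: M)
  qed
next
  case (eL \<Sigma> A B T)
  have g: "gnf Th R A" "gnf Th R B" using derivable_sequent[OF eL.hyps(3)] by (auto simp: sequent_def)
  have 1: "derivable Th R False (insert A (insert B \<Gamma>)) T"
    using eL.prems g by (intro eL.IH) (auto intro: introducible_insert weaken_insert)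
  have 2: "derivable Th R False \<Gamma> B" by (rule eL.IH(1)[OF eL.prems])
  show ?case
  proof (cases "Enc A B \<in> \<Gamma>")
    case True
    from eL'[OF True 2 1] show ?thesis .
  next
    case False
    with eL.prems(1) have M: "M = Enc A B" by blast
    have "derivable Th R False (insert B \<Gamma>) A"
      using eL.prems(2,3) g by (auto simp: M intro: weaken_insert)
    then show ?thesis
      using 1 2 smaller[of A "insert B \<Gamma>" T] smaller[of B \<Gamma> T] by (simp add: M)
  qed
next
  case (signL \<Sigma> A K L T)
  have g: "gnf Th R A" using derivable_sequent[OF signL.hyps(3)] by (simp add: sequent_def)
  have 1: "derivable Th R False (insert A \<Gamma>) T"
    using signL.prems g by (intro signL.IH) (auto intro: introducible_insert weaken_insert)
  \<comment> \<open>A \<open>Pub\<close> term is never introducible, so the public key stays in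
    \<open>\<Gamma>\<close>.\<close>
  have "M \<noteq> Pub L" using signL.prems(3) by auto
  with signL.prems(1) have L: "Pub L \<in> \<Gamma>" by auto
  show ?case
  proof (cases "Sign A K \<in> \<Gamma>")
    case True
    from signL'[OF True L signL.hyps(2) 1] show ?thesis .
  next
    case False
    with signL.prems(1) have M: "M = Sign A K" by blast
    with signL.prems(3) 1 smaller[of A \<Gamma> T] show ?thesis by simp
  qed
next
  case (blindL1 \<Sigma> A B T)
  have g: "gnf Th R A" "gnf Th R B"
    using derivable_sequent[OF blindL1.hyps(3)] by (auto simp: sequent_def)
  have 1: "derivable Th R False (insert A (insert B \<Gamma>)) T"
    using blindL1.prems g by (intro blindL1.IH) (auto intro: introducible_insert weaken_insert)
  have 2: "derivable Th R False \<Gamma> B" by (rule blindL1.IH(1)[OF blindL1.prems])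
  show ?case
  proof (cases "Blind A B \<in> \<Gamma>")
    case True
    from blindL1'[OF True 2 1] show ?thesis .
  next
    case False
    with blindL1.prems(1) have M: "M = Blind A B" by blast
    have "derivable Th R False (insert B \<Gamma>) A"
      using blindL1.prems(2,3) g by (auto simp: M intro: weaken_insert)
    then show ?thesis
      using 1 2 smaller[of A "insert B \<Gamma>" T] smaller[of B \<Gamma> T] by (simp add: M)
  qed
next
  case (blindL2 \<Sigma> A S K T)
  have g: "gnf Th R (Sign A K)" "gnf Th R S" "gnf Th R (Sign (Blind A S) K)"
    using derivable_sequent[OF blindL2.hyps(3)] by (auto simp: sequent_def)
  have g': "gnf Th R A" "gnf Th R (Blind A S)"
    using gnf_args(1)[OF g(3)] gnf_args(2) by blast+
  have 1: "derivable Th R False (insert (Sign A K) (insert S \<Gamma>)) T"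
    using blindL2.prems g(1,2)
    by (intro blindL2.IH) (auto simp del: is_term.simps ground.simps intro: introducible_insert weaken_insert)
  have 2: "derivable Th R False \<Gamma> S" by (rule blindL2.IH(1)[OF blindL2.prems])
  show ?case
  proof (cases "Sign (Blind A S) K \<in> \<Gamma>")
    case True
    from blindL2'[OF True 2 1] show ?thesis .
  next
    case False
    with blindL2.prems(1) have M: "M = Sign (Blind A S) K" by blast
    \<comment> \<open>The left derivation provides \<open>Blind A S\<close> but not
      \<open>A\<close>. Unblinding with \<open>S\<close> and a smaller cut on
      \<open>Blind A S\<close> yield \<open>A\<close>; then \<open>signR\<close> builds
      \<open>Sign A K\<close>, again smaller than \<open>M\<close>.\<close>
    have "derivable Th R False (insert (Blind A S) \<Gamma>) A"
    proof (rule blindL1')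
      show "Blind A S \<in> insert (Blind A S) \<Gamma>" by blast
      show "derivable Th R False (insert (Blind A S) \<Gamma>) S"
        using 2 by (rule weaken) (use blindL2.prems(2) g' in auto)
      show "derivable Th R False (insert A (insert S (insert (Blind A S) \<Gamma>))) A"
        using blindL2.prems(2) g g' derivable_num[OF 2]
        by (intro derivable_mem) (auto simp: sequent_def)
    qed
    moreover have BK: "derivable Th R False \<Gamma> (Blind A S)" "derivable Th R False \<Gamma> K"
      using blindL2.prems(3) by (auto simp: M)
    ultimately have "derivable Th R False \<Gamma> A"
      using smaller[of "Blind A S" \<Gamma> A] by (simp add: M)
    then have "derivable Th R False \<Gamma> (Sign A K)"
      using BK(2) g(1) blindL2.prems(2) by (intro derivable.signR) (auto simp: sequent_def)
    then have "derivable Th R False (insert S \<Gamma>) (Sign A K)"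
      by (rule weaken) (use blindL2.prems(2) g in auto)
    then show ?thesis
      using 1 2 smaller[of "Sign A K" "insert S \<Gamma>" T] smaller[of S \<Gamma> T] by (simp add: M)
  qed
next
  case (pR \<Sigma> A B)
  show ?case
    by (rule derivable.pR[OF sequent_eqAC[OF pR.hyps(1) eqAC_refl pR.prems(2)]
          pR.IH(1)[OF pR.prems] pR.IH(2)[OF pR.prems]])
next
  case (eR \<Sigma> A B)
  show ?case
    by (rule derivable.eR[OF sequent_eqAC[OF eR.hyps(1) eqAC_refl eR.prems(2)]
          eR.IH(1)[OF eR.prems] eR.IH(2)[OF eR.prems]])
next
  case (signR \<Sigma> A B)
  show ?case
    by (rule derivable.signR[OF sequent_eqAC[OF signR.hyps(1) eqAC_refl signR.prems(2)]
          signR.IH(1)[OF signR.prems] signR.IH(2)[OF signR.prems]])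
next
  case (blindR \<Sigma> A B)
  show ?case
    by (rule derivable.blindR[OF sequent_eqAC[OF blindR.hyps(1) eqAC_refl blindR.prems(2)]
          blindR.IH(1)[OF blindR.prems] blindR.IH(2)[OF blindR.prems]])
qed simp

text \<open>Induction on the left derivation. Left rules let the cut move up into a premise with the
  same cut formula; right rules hand over to \<open>cut_introducible\<close>. The bound
  \<open>n\<close> is kept apart from \<open>M\<close>, which varies in the rule induction.\<close>

lemma cut_same_size:
  assumes smaller: "\<And>N \<Gamma> T. \<lbrakk>size N < n; derivable Th R False \<Gamma> N;
      derivable Th R False (insert N \<Gamma>) T\<rbrakk> \<Longrightarrow> derivable Th R False \<Gamma> T"
  shows "\<lbrakk>derivable Th R False \<Gamma> M; size M = n; derivable Th R False (insert M \<Gamma>) T\<rbrakk>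
    \<Longrightarrow> derivable Th R False \<Gamma> T"
proof (induction rule: derivable.induct)
  case (id \<Gamma> M i C Ms)
  have D: "fill C Ms \<in> layer Th i \<Gamma>" using id.hyps by (blast intro: fill_layer)
  have M: "derivable Th R False \<Gamma> M" using id.hyps by (rule derivable.id)
  have g: "gnf Th R M" "\<forall>N\<in>\<Gamma>. gnf Th R N" using id.hyps(1) by (auto simp: sequent_def)
  show ?case
  proof (cases "alien Th i M")
    case True
    \<comment> \<open>A context of another theory can only have extracted \<open>M\<close>, up to
      AC, from a member of \<open>\<Gamma>\<close>.\<close>
    have "\<exists>s\<in>\<Gamma>. \<exists>b\<in>aliens Th i s. eqAC Th M b"
      using alien_eqE_layer[OF id.hyps(2) _ True D _ id.hyps(6)] g by simp
    then obtain s b where b: "s \<in> \<Gamma>" "b \<in> aliens Th i s" "eqAC Th M b" by blast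
    from cut_alien[OF id.hyps(2) insertI2[OF b(1)] b(2,3) M id.prems(2)] show ?thesis .
  next
    case False
    then obtain f ts where "M = Fn f ts" "f \<in> sig_of Th i" by (auto simp: alien_def)
    with id.hyps(2,6) D have intr: "introducible \<Gamma> M" by auto
    show ?thesis
      by (rule cut_introducible[OF smaller id.prems(2) subset_refl g(2) intr M])
        (simp_all add: id.prems(1))
  qed
next
  case (acut \<Gamma> M i P N)
  have N: "gnf Th R N" using derivable_sequent[OF acut.hyps(5)] by (simp add: sequent_def)
  have "derivable Th R False (insert M (insert N \<Gamma>)) T"
    using weaken_insert[OF acut.prems(2) N] by (simp add: insert_commute)
  then have 1: "derivable Th R False (insert N \<Gamma>) T"
    using acut.IH(2)[OF acut.prems(1), unfolded Un_insert_right Un_empty_right] by blast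
  show ?case
  \<comment> \<open>After the cut \<open>M\<close> is no longer in the sequent, so a factor of
    \<open>M\<close> cannot justify \<open>acut\<close>; being smaller, it is cut instead. Otherwise
    \<open>P\<close> lies in \<open>\<Gamma>\<close> and \<open>acut\<close> is reapplied.\<close>
  proof (cases "P = M")
    case True
    with acut.hyps(4) acut.prems(1) factor_size have "size N < n" by blast
    from smaller[OF this acut.hyps(5) 1] show ?thesis .
  next
    case False
    with acut.hyps(3) have "P \<in> insert T \<Gamma>" by blast
    from acut'[OF acut.hyps(2) this acut.hyps(4,5) 1] show ?thesis .
  qed
next
  case (pL \<Gamma> A B M)
  have "derivable Th R False (insert M (\<Gamma> \<union> {MPair A B, A, B})) T"
    by (rule weaken_context[OF pL.prems(2) pL.hyps(2)]) blast
  from pL.IH[OF pL.prems(1) this] have "derivable Th R False (\<Gamma> \<union> {MPair A B, A, B}) T" .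
  from derivable.pL[OF sequent_mono[OF derivable_sequent[OF pL.prems(2)] subset_insertI]
      this]
  show ?case .
next
  case (eL \<Gamma> A B M)
  have "derivable Th R False (insert M (\<Gamma> \<union> {Enc A B, A, B})) T"
    by (rule weaken_context[OF eL.prems(2) eL.hyps(3)]) blast
  from eL.IH(2)[OF eL.prems(1) this] have "derivable Th R False (\<Gamma> \<union> {Enc A B, A, B}) T" .
  from derivable.eL[OF sequent_mono[OF derivable_sequent[OF eL.prems(2)] subset_insertI]
      eL.hyps(2) this]
  show ?case .
next
  case (signL \<Gamma> A K L M)
  have "derivable Th R False (insert M (\<Gamma> \<union> {Sign A K, Pub L, A})) T"
    by (rule weaken_context[OF signL.prems(2) signL.hyps(3)]) blast
  from signL.IH[OF signL.prems(1) this]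
  have "derivable Th R False (\<Gamma> \<union> {Sign A K, Pub L, A}) T" .
  from derivable.signL[OF sequent_mono[OF derivable_sequent[OF signL.prems(2)] subset_insertI]
      signL.hyps(2) this]
  show ?case .
next
  case (blindL1 \<Gamma> A B M)
  have "derivable Th R False (insert M (\<Gamma> \<union> {Blind A B, A, B})) T"
    by (rule weaken_context[OF blindL1.prems(2) blindL1.hyps(3)]) blast
  from blindL1.IH(2)[OF blindL1.prems(1) this]
  have "derivable Th R False (\<Gamma> \<union> {Blind A B, A, B}) T" .
  from derivable.blindL1[OF sequent_mono[OF derivable_sequent[OF blindL1.prems(2)] subset_insertI]
      blindL1.hyps(2) this]
  show ?case .
next
  case (blindL2 \<Gamma> A S K M)
  have "derivable Th R False (insert M (\<Gamma> \<union> {Sign (Blind A S) K, Sign A K, S})) T"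
    by (rule weaken_context[OF blindL2.prems(2) blindL2.hyps(3)]) blast
  from blindL2.IH(2)[OF blindL2.prems(1) this]
  have "derivable Th R False (\<Gamma> \<union> {Sign (Blind A S) K, Sign A K, S}) T" .
  from derivable.blindL2[OF sequent_mono[OF derivable_sequent[OF blindL2.prems(2)] subset_insertI]
      blindL2.hyps(2) this]
  show ?case .
next
  case (pR \<Gamma> A B)
  then have "introducible \<Gamma> (MPair A B)" "derivable Th R False \<Gamma> (MPair A B)"
    by (auto intro: derivable.pR)
  from cut_introducible[OF _ pR.prems(2) _ _ this] pR.prems(1) pR.hyps(1) smaller
  show ?case by (auto simp: sequent_def)
next
  case (eR \<Gamma> A B)
  then have "introducible \<Gamma> (Enc A B)" "derivable Th R False \<Gamma> (Enc A B)"
    by (auto intro: derivable.eR)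
  from cut_introducible[OF _ eR.prems(2) _ _ this] eR.prems(1) eR.hyps(1) smaller
  show ?case by (auto simp: sequent_def)
next
  case (signR \<Gamma> A B)
  then have "introducible \<Gamma> (Sign A B)" "derivable Th R False \<Gamma> (Sign A B)"
    by (auto intro: derivable.signR)
  from cut_introducible[OF _ signR.prems(2) _ _ this] signR.prems(1) signR.hyps(1) smaller
  show ?case by (auto simp: sequent_def)
next
  case (blindR \<Gamma> A B)
  then have "introducible \<Gamma> (Blind A B)" "derivable Th R False \<Gamma> (Blind A B)"
    by (auto intro: derivable.blindR)
  from cut_introducible[OF _ blindR.prems(2) _ _ this] blindR.prems(1) blindR.hyps(1) smaller
  show ?case by (auto simp: sequent_def)
qed simp

theorem cut_admissible:
  "derivable Th R False \<Gamma> M \<Longrightarrow> derivable Th R False (insert M \<Gamma>) T \<Longrightarrow> derivable Th R False \<Gamma> T"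
proof (induction M arbitrary: \<Gamma> T rule: measure_induct_rule[of size])
  case (less M)
  show ?case by (rule cut_same_size[OF less.IH less.prems(1) HOL.refl less.prems(2)])
qed

end

theorem theorem5p4:
  fixes Th :: "('f, 'n) comb" and R :: "('f, 'n) eqns"
    and \<Gamma> :: "('f, 'n) msg set" and M :: "('f, 'n) msg"
  assumes "disjoint_combination Th"
    and "presents Th R"
    and "terminating_AC Th R"
    and "confluent_AC Th R"
    and "derivable Th R True \<Gamma> M"
  shows "derivable Th R False \<Gamma> M"
proof -
  interpret combination Th R
    using assms(1-4) by unfold_locales
  show ?thesis
    using assms(5)
  proof (induction rule: derivable.induct)
    \<comment> \<open>The induction removes topmost cuts first: both premises already have cut-free
      derivations.\<close>
    case (cut \<Gamma> T M)
    then show ?case using cut_admissible by simp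
  qed (auto simp del: Un_insert_right intro: derivable.intros)
qed

end
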